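(* Let $\mathcal{S}=\{({\bf u}_t,{\bf p},\binom{B_t}{P_t}):t\in\mathbb{T}_r\}$ and $\overline{\mathcal{S}}=\{(\overline{\bf u}_t,\overline{\bf p},\binom{\overline B_t}{\overline P_t}):t\in\mathbb{T}_r\}$ be two seed patterns of geometric type with respective extended ranks $(r,l)$ and $(r,\overline{l})$. Let $t_0,\overline{t}_0\in\mathbb{T}_r$ be such that $B_{t_0}=\overline B_{\overline{t}_0}$, and let $E\in M_{\overline{l},l}(\mathbb{Z})$ satisfy $EP_{t_0}=\overline P_{\overline{t}_0}$. Then the cluster algebra quasi-homomorphism $\psi:\mathcal{A}_{\mathbb Q}(\mathcal{S})\to\mathcal{A}_{\mathbb Q}(\overline{\mathcal{S}})$ determined by $\psi({\bf u}_{t_0},{\bf p})=(\overline{\bf u}_{\overline{t}_0},\overline{\bf p}^E)$ has Property $\mathfrak{F}$ if and only if $E\ge0$.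
   Context: Notation: $[m,n]$ is the set of integers $k$ with $m\le k\le n$; $[a]_+=\max(a,0)$, applied entrywise to integer matrices; $M\ge0$ means all entries of $M$ are non-negative; $M_{m,n}(\mathbb{Z})$ is the set of $m\times n$ integer matrices. For ${\bf a}=(a_1,\dots,a_n)$ and an integer column vector $L=(l_1,\dots,l_n)^T$, ${\bf a}^L=a_1^{l_1}\cdots a_n^{l_n}$; if $L$ is a matrix with columns $L_1,\dots,L_m$, ${\bf a}^L=({\bf a}^{L_1},\dots,{\bf a}^{L_m})$; products of tuples are componentwise. Cluster algebras of geometric type. Let $\mathbb{F}$ be a field of rational functions over $\mathbb{Q}$ in $r+l$ independent variables. A seed of extended rank $(r,l)$ in $\mathbb F$ is $\Sigma=({\bf u},{\bf p},\widetilde B)$, where ${\bf u}=(u_1,\ldots,u_r)$ and ${\bf p}=(p_1,\ldots,p_l)$ together freely generate $\mathbb{F}$ over $\mathbb{Q}$, and $\widetilde B=\binom{B}{P}=(b_{i,j})$ is an $(r+l)\times r$ integer matrix whose top $r\times r$ part $B$ is skew-symmetrizable. With $B_k,P_k$ the $k$th columns of $B,P$, the mutation $\mu_k(\Sigma)=({\bf u}',{\bf p},\widetilde B')$, $k\in[1,r]$, has $u'_j=u_j$ for $j\ne k$, $u_ku_k'={\bf u}^{[B_k]_+}{\bf p}^{[P_k]_+}+{\bf u}^{[-B_k]_+}{\bf p}^{[-P_k]_+}$, and $b'_{i,j}=-b_{i,j}$ if $i=k$ or $j=k$, $b'_{i,j}=b_{i,j}+[b_{i,k}]_+[b_{k,j}]_+-[-b_{i,k}]_+[-b_{k,j}]_+$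 otherwise. Let $\mathbb{T}_r$ be the $r$-regular tree with edges at each vertex labelled by $[1,r]$. A seed pattern assigns a seed $\Sigma_t$ to each vertex $t\in\mathbb{T}_r$ so that $\Sigma_{t'}=\mu_k(\Sigma_t)$ whenever $t,t'$ are joined by an edge labelled $k$. Entries of the ${\bf u}_t$ are cluster variables, entries of ${\bf p}$ are frozen variables; $\widetilde{\mathfrak X}(\mathcal{S})$ is the set of all of them. $\mathcal{A}_{\mathbb Z}(\mathcal{S},\emptyset)\subset\mathbb{F}$ is the subring generated by $\widetilde{\mathfrak X}(\mathcal{S})$; $\mathcal{A}_{\mathbb Q}(\mathcal{S})\subset\mathbb{F}$ is the $\mathbb{Q}$-algebra generated by $\widetilde{\mathfrak X}(\mathcal{S})$ and the inverses of all frozen variables. Quasi-homomorphisms: a cluster algebra quasi-homomorphism $\psi:\mathcal{A}_{\mathbb Q}(\mathcal{S})\to\mathcal{A}_{\mathbb Q}(\overline{\mathcal{S}})$ is a $\mathbb{Q}$-algebra homomorphism such that $\psi({\bf u}_{t_0},{\bf p})=(\overline{\bf u}_{\overline t_0}\overline{\bf p}^R,\overline{\bf p}^E)$ (componentwise) for some $t_0,\overline t_0\in\mathbb{T}_r$, $R\in M_{\overline l,r}(\mathbb{Z})$, $E\in M_{\overline l,l}(\mathbb{Z})$ with $B_{t_0}=\overline B_{\overline t_0}$ and $RB_{t_0}+EP_{t_0}=\overline P_{\overline t_0}$; for any such data $\psi$ exists and is unique. The corollary concerns the case $R=0$. Property $\mathfrak{F}$: let $\mathcal{A}^+_{\mathbb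 Z}(\mathcal{S},\emptyset)\subset\mathcal{A}_{\mathbb Z}(\mathcal{S},\emptyset)$ be the semiring (with $1$ but without $0$) generated by $\widetilde{\mathfrak X}(\mathcal{S})$. A ring homomorphism $\mathcal{A}_{\mathbb Z}(\mathcal{S},\emptyset)\to\mathcal{A}_{\mathbb Z}(\mathcal{S}',\emptyset)$ has Property $\mathfrak{F}$ if it maps $\widetilde{\mathfrak X}(\mathcal{S})$ into $\mathcal{A}^+_{\mathbb Z}(\mathcal{S}',\emptyset)$. A $\mathbb{Q}$-algebra homomorphism $\mathcal{A}_{\mathbb Q}(\mathcal{S})\to\mathcal{A}_{\mathbb Q}(\mathcal{S}')$ has Property $\mathfrak{F}$ if it induces a ring homomorphism $\mathcal{A}_{\mathbb Z}(\mathcal{S},\emptyset)\to\mathcal{A}_{\mathbb Z}(\mathcal{S}',\emptyset)$ with Property $\mathfrak{F}$. *)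

theory Defs
  imports
    "Jordan_Normal_Form.Matrix"
    "HOL-Library.Poly_Mapping"
begin

text \<open>
  All index sets are shifted to start at \<open>0\<close>: the interval \<open>[1,r]\<close> becomes \<open>{..<r}\<close>, and in an
  extended exchange matrix the rows \<open>0, \<dots>, r - 1\<close> belong to the cluster variables and the rows
  \<open>r, \<dots>, r + l - 1\<close> to the frozen variables.  The ambient field \<open>\<F>\<close> of a seed is the whole type
  \<^typ>\<open>'a::field_char_0\<close>; that it is a field of rational functions over the rationals in \<open>r + l\<close>
  independent variables is part of the definition of a seed (free generation).
\<close>

section \<open>Generated subrings, semirings, algebras and subfields\<close>

inductive_set ring_generated :: "'a::comm_ring_1 set \<Rightarrow> 'a set" for X where
  base: "x \<in> X \<Longrightarrow> x \<in> ring_generated X"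
| one: "1 \<in> ring_generated X"
| add: "x \<in> ring_generated X \<Longrightarrow> y \<in> ring_generated X \<Longrightarrow> x + y \<in> ring_generated X"
| uminus: "x \<in> ring_generated X \<Longrightarrow> - x \<in> ring_generated X"
| mult: "x \<in> ring_generated X \<Longrightarrow> y \<in> ring_generated X \<Longrightarrow> x * y \<in> ring_generated X"

text \<open>Semirings here contain \<open>1\<close> but are not required to contain \<open>0\<close>.\<close>

inductive_set semiring_generated :: "'a::comm_ring_1 set \<Rightarrow> 'a set" for X where
  base: "x \<in> X \<Longrightarrow> x \<in> semiring_generated X"
| one: "1 \<in> semiring_generated X"
| add: "x \<in> semiring_generated X \<Longrightarrow> y \<in> semiring_generated X \<Longrightarrow> x + y \<in> semiring_generated X"
| mult: "x \<in> semiring_generated X \<Longrightarrow> y \<in> semiring_generated X \<Longrightarrow> x * y \<in> semiring_generated X"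

inductive_set rat_algebra_generated :: "'a::field_char_0 set \<Rightarrow> 'a set" for X where
  base: "x \<in> X \<Longrightarrow> x \<in> rat_algebra_generated X"
| scalar: "of_rat q \<in> rat_algebra_generated X"
| add: "x \<in> rat_algebra_generated X \<Longrightarrow> y \<in> rat_algebra_generated X
    \<Longrightarrow> x + y \<in> rat_algebra_generated X"
| mult: "x \<in> rat_algebra_generated X \<Longrightarrow> y \<in> rat_algebra_generated X
    \<Longrightarrow> x * y \<in> rat_algebra_generated X"

inductive_set field_generated :: "'a::field_char_0 set \<Rightarrow> 'a set" for X where
  base: "x \<in> X \<Longrightarrow> x \<in> field_generated X"
| one: "1 \<in> field_generated X"
| add: "x \<in> field_generated X \<Longrightarrow> y \<in> field_generated X \<Longrightarrow> x + y \<in> field_generated X"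
| uminus: "x \<in> field_generated X \<Longrightarrow> - x \<in> field_generated X"
| mult: "x \<in> field_generated X \<Longrightarrow> y \<in> field_generated X \<Longrightarrow> x * y \<in> field_generated X"
| inverse: "x \<in> field_generated X \<Longrightarrow> inverse x \<in> field_generated X"

section \<open>Homomorphisms between subrings and subalgebras of fields\<close>

text \<open>A homomorphism with domain \<open>A\<close> is a function on the whole ambient type of which only the
  values on \<open>A\<close> matter.\<close>

definition ring_hom_on :: "'a::comm_ring_1 set \<Rightarrow> 'b::comm_ring_1 set \<Rightarrow> ('a \<Rightarrow> 'b) \<Rightarrow> bool" where
  "ring_hom_on A A' f \<longleftrightarrow> f ` A \<subseteq> A' \<and> f 1 = 1 \<and>
     (\<forall>x\<in>A. \<forall>y\<in>A. f (x + y) = f x + f y \<and> f (x * y) = f x * f y)"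

definition rat_algebra_hom_on ::
    "'a::field_char_0 set \<Rightarrow> 'b::field_char_0 set \<Rightarrow> ('a \<Rightarrow> 'b) \<Rightarrow> bool" where
  "rat_algebra_hom_on A A' f \<longleftrightarrow> ring_hom_on A A' f \<and>
     (\<forall>q. \<forall>x\<in>A. f (of_rat q * x) = of_rat q * f x)"

section \<open>Free generation\<close>

text \<open>A polynomial over the rationals is a finitely supported map from exponent vectors
  \<^typ>\<open>nat \<Rightarrow>\<^sub>0 nat\<close> to coefficients.\<close>

definition poly_eval :: "'a::field_char_0 vec \<Rightarrow> ((nat \<Rightarrow>\<^sub>0 nat) \<Rightarrow>\<^sub>0 rat) \<Rightarrow> 'a" where
  "poly_eval x f = (\<Sum>m\<in>Poly_Mapping.keys f. of_rat (Poly_Mapping.lookup f m) *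
     (\<Prod>i\<in>Poly_Mapping.keys m. (x $ i) ^ Poly_Mapping.lookup m i))"

definition alg_independent :: "'a::field_char_0 vec \<Rightarrow> bool" where
  "alg_independent x \<longleftrightarrow>
     (\<forall>f. (\<forall>m\<in>Poly_Mapping.keys f. Poly_Mapping.keys m \<subseteq> {..<dim_vec x}) \<longrightarrow>
        poly_eval x f = 0 \<longrightarrow> f = 0)"

definition freely_generates :: "'a::field_char_0 vec \<Rightarrow> bool" where
  "freely_generates x \<longleftrightarrow> alg_independent x \<and> field_generated (set\<^sub>v x) = UNIV"

section \<open>Monomials\<close>

definition vec_power :: "'a::field vec \<Rightarrow> int vec \<Rightarrow> 'a" where
  "vec_power a L = (\<Prod>i<dim_vec a. (a $ i) powi (L $ i))"

definition mat_power :: "'a::field vec \<Rightarrow> int mat \<Rightarrow> 'a vec" where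
  "mat_power a L = vec (dim_col L) (\<lambda>j. vec_power a (col L j))"

definition tuple_mult :: "'a::times vec \<Rightarrow> 'a vec \<Rightarrow> 'a vec" where
  "tuple_mult a b = vec (dim_vec a) (\<lambda>i. a $ i * b $ i)"

definition pos_part :: "int \<Rightarrow> int" where
  "pos_part a = max a 0"

section \<open>Seeds and mutations\<close>

record 'a seed =
  cluster :: "'a vec"
  frozen :: "'a vec"
  exmat :: "int mat"

definition exchange_part :: "'a seed \<Rightarrow> int mat" where
  "exchange_part \<Sigma> = mat (dim_vec (cluster \<Sigma>)) (dim_vec (cluster \<Sigma>)) (\<lambda>(i, j). exmat \<Sigma> $$ (i, j))"

definition coefficient_part :: "'a seed \<Rightarrow> int mat" where
  "coefficient_part \<Sigma> = mat (dim_vec (frozen \<Sigma>)) (dim_vec (cluster \<Sigma>))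
     (\<lambda>(i, j). exmat \<Sigma> $$ (dim_vec (cluster \<Sigma>) + i, j))"

definition skew_symmetrizable :: "int mat \<Rightarrow> bool" where
  "skew_symmetrizable B \<longleftrightarrow> square_mat B \<and>
     (\<exists>d :: nat \<Rightarrow> int. (\<forall>i<dim_row B. d i > 0) \<and>
        (\<forall>i<dim_row B. \<forall>j<dim_row B. d i * B $$ (i, j) = - (d j * B $$ (j, i))))"

definition is_seed :: "nat \<Rightarrow> nat \<Rightarrow> 'a::field_char_0 seed \<Rightarrow> bool" where
  "is_seed r l \<Sigma> \<longleftrightarrow>
     cluster \<Sigma> \<in> carrier_vec r \<and> frozen \<Sigma> \<in> carrier_vec l \<and> exmat \<Sigma> \<in> carrier_mat (r + l) r \<and>
     freely_generates (cluster \<Sigma> @\<^sub>v frozen \<Sigma>) \<and> skew_symmetrizable (exchange_part \<Sigma>)"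

definition mutate_mat :: "nat \<Rightarrow> int mat \<Rightarrow> int mat" where
  "mutate_mat k M = mat (dim_row M) (dim_col M) (\<lambda>(i, j).
     if i = k \<or> j = k then - (M $$ (i, j))
     else M $$ (i, j) + pos_part (M $$ (i, k)) * pos_part (M $$ (k, j))
                      - pos_part (- (M $$ (i, k))) * pos_part (- (M $$ (k, j))))"

definition exchange_binomial :: "nat \<Rightarrow> 'a::field_char_0 seed \<Rightarrow> 'a" where
  "exchange_binomial k \<Sigma> =
     (let b = col (exchange_part \<Sigma>) k; c = col (coefficient_part \<Sigma>) k in
        vec_power (cluster \<Sigma>) (map_vec pos_part b) * vec_power (frozen \<Sigma>) (map_vec pos_part c)
      + vec_power (cluster \<Sigma>) (map_vec pos_part (- b)) * vec_power (frozen \<Sigma>) (map_vec pos_part (- c)))"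

definition mutate :: "nat \<Rightarrow> 'a::field_char_0 seed \<Rightarrow> 'a seed" where
  "mutate k \<Sigma> = \<lparr>
     cluster = vec (dim_vec (cluster \<Sigma>))
       (\<lambda>j. if j = k then exchange_binomial k \<Sigma> / cluster \<Sigma> $ k else cluster \<Sigma> $ j),
     frozen = frozen \<Sigma>,
     exmat = mutate_mat k (exmat \<Sigma>)\<rparr>"

section \<open>Seed patterns\<close>

text \<open>The \<open>r\<close>-regular tree with edges labelled by \<open>{..<r}\<close>, each label occurring exactly once at
  every vertex, is unique up to label-preserving isomorphism.  It is realised as the Cayley graph
  of the free product of \<open>r\<close> copies of the group of order two: vertices are the words without two
  equal adjacent letters, and prefixing the letter \<open>k\<close> is an edge labelled \<open>k\<close>.\<close>

definition tree_vertices :: "nat \<Rightarrow> nat list set" where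
  "tree_vertices r = {w. set w \<subseteq> {..<r} \<and> distinct_adj w}"

definition tree_edge :: "nat \<Rightarrow> nat \<Rightarrow> nat list \<Rightarrow> nat list \<Rightarrow> bool" where
  "tree_edge r k t t' \<longleftrightarrow> k < r \<and> t \<in> tree_vertices r \<and> t' \<in> tree_vertices r \<and>
     (t' = k # t \<or> t = k # t')"

definition seed_pattern :: "nat \<Rightarrow> nat \<Rightarrow> (nat list \<Rightarrow> 'a::field_char_0 seed) \<Rightarrow> bool" where
  "seed_pattern r l S \<longleftrightarrow>
     (\<forall>t\<in>tree_vertices r. is_seed r l (S t)) \<and>
     (\<forall>k t t'. tree_edge r k t t' \<longrightarrow> S t' = mutate k (S t))"

definition cluster_variables :: "nat \<Rightarrow> (nat list \<Rightarrow> 'a seed) \<Rightarrow> 'a set" where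
  "cluster_variables r S = (\<Union>t\<in>tree_vertices r. set\<^sub>v (cluster (S t)))"

definition frozen_variables :: "nat \<Rightarrow> (nat list \<Rightarrow> 'a seed) \<Rightarrow> 'a set" where
  "frozen_variables r S = (\<Union>t\<in>tree_vertices r. set\<^sub>v (frozen (S t)))"

definition all_variables :: "nat \<Rightarrow> (nat list \<Rightarrow> 'a seed) \<Rightarrow> 'a set" where
  "all_variables r S = cluster_variables r S \<union> frozen_variables r S"

definition cluster_ring_int :: "nat \<Rightarrow> (nat list \<Rightarrow> 'a::field_char_0 seed) \<Rightarrow> 'a set" where
  "cluster_ring_int r S = ring_generated (all_variables r S)"

definition cluster_semiring :: "nat \<Rightarrow> (nat list \<Rightarrow> 'a::field_char_0 seed) \<Rightarrow> 'a set" where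
  "cluster_semiring r S = semiring_generated (all_variables r S)"

definition cluster_algebra_rat :: "nat \<Rightarrow> (nat list \<Rightarrow> 'a::field_char_0 seed) \<Rightarrow> 'a set" where
  "cluster_algebra_rat r S =
     rat_algebra_generated (all_variables r S \<union> inverse ` frozen_variables r S)"

section \<open>Quasi-homomorphisms and Property F\<close>

definition quasi_homomorphism ::
    "nat \<Rightarrow> nat \<Rightarrow> nat \<Rightarrow> (nat list \<Rightarrow> 'a::field_char_0 seed) \<Rightarrow> (nat list \<Rightarrow> 'b::field_char_0 seed)
     \<Rightarrow> ('a \<Rightarrow> 'b) \<Rightarrow> bool" where
  "quasi_homomorphism r l l' S S' \<psi> \<longleftrightarrow>
     rat_algebra_hom_on (cluster_algebra_rat r S) (cluster_algebra_rat r S') \<psi> \<and>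
     (\<exists>t\<in>tree_vertices r. \<exists>t'\<in>tree_vertices r. \<exists>R\<in>carrier_mat l' r. \<exists>E\<in>carrier_mat l' l.
        exchange_part (S t) = exchange_part (S' t') \<and>
        R * exchange_part (S t) + E * coefficient_part (S t) = coefficient_part (S' t') \<and>
        map_vec \<psi> (cluster (S t)) = tuple_mult (cluster (S' t')) (mat_power (frozen (S' t')) R) \<and>
        map_vec \<psi> (frozen (S t)) = mat_power (frozen (S' t')) E)"

text \<open>The first conjunct of \<open>property_F\<close> says that \<open>\<psi>\<close> induces (by restriction) a ring homomorphism
  between the integral rings.\<close>

definition property_F ::
    "nat \<Rightarrow> (nat list \<Rightarrow> 'a::field_char_0 seed) \<Rightarrow> (nat list \<Rightarrow> 'b::field_char_0 seed)
     \<Rightarrow> ('a \<Rightarrow> 'b) \<Rightarrow> bool" where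
  "property_F r S S' \<psi> \<longleftrightarrow>
     ring_hom_on (cluster_ring_int r S) (cluster_ring_int r S') \<psi> \<and>
     \<psi> ` all_variables r S \<subseteq> cluster_semiring r S'"

end

theory Submission
  imports Defs "HOL-Computational_Algebra.Polynomial"
begin

text \<open>
  Along the tree, \<open>\<psi>\<close> sends a cluster variable to the corresponding cluster variable times a monomial
  \<open>p'\<^sup>\<rho>\<close> in the frozen variables.  The exponent \<open>\<rho> i\<close> obeys the exchange relations read in the min-plus
  semiring: it is the order of vanishing, for \<open>s \<rightarrow> 0\<close>, of the original cluster variable at \<open>u = 1\<close>,
  \<open>p\<^sub>a = s\<^bsup>E i a\<^esup>\<close>.  By the Laurent phenomenon a cluster variable is a Laurent polynomial in the initial
  variables, and it is polynomial in the frozen ones, because its order along \<open>p\<^sub>a = 0\<close> is zero for each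
  single \<open>a\<close>.  So it stays bounded on that curve if \<open>E \<ge> 0\<close>, whence \<open>\<rho> \<ge> 0\<close>.

  Conversely, setting one \<open>p' i\<close> to \<open>0\<close> and all other initial variables to \<open>1\<close> gives finite values to
  all cluster variables, hence to every element of the integral cluster ring.  A monomial in the
  frozen variables with negative exponent at \<open>p' i\<close> has no finite value there.

  The Laurent phenomenon is proved for functions on positive real vectors, by induction on the length of
  the mutation sequence \<open>k, m, \<dots>\<close>: the variable is Laurent in the seed after the step \<open>k\<close> and in the
  seed after \<open>k, m, k\<close>, and the two resulting denominators are coprime.
\<close>

section \<open>Laurent polynomial functions\<close>

text \<open>The min-plus recursion subtracts the old exponent, so no sign can be read off it by
  induction along the tree; this forces the detour through functions. The exponents depend only on
  \<open>E\<close>, the extended exchange matrix at \<open>t\<^sub>0\<close> and the walk, not on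
  the two fields, so \<open>mut_trop_seq_nonneg\<close> can be proved over the reals and then used
  for \<open>\<psi>\<close>. Positive vectors suit this purpose: mutation is subtraction-free, so
  nothing vanishes there and orders of sums are minima. Divisibility arguments, however, need zeros
  of exchange polynomials, and these lie outside the positive vectors;
  \<open>laurent_identity\<close> carries identities over to all vectors without zero coordinates.
  Two devices replace unique factorisation. An auxiliary frozen row with entry 1 makes the exchange
  polynomial linear in one variable, hence prime; and coprimality to it becomes a cancellation law,
  certified by a single point where it vanishes and the other factor does not.\<close>

inductive_set laurent :: "nat set \<Rightarrow> ((nat \<Rightarrow> real) \<Rightarrow> real) set" for I where
  const: "(\<lambda>x. c) \<in> laurent I"
| var: "(\<lambda>x. x i) \<in> laurent I"
| inv: "i \<in> I \<Longrightarrow> (\<lambda>x. inverse (x i)) \<in> laurent I"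
| add: "F \<in> laurent I \<Longrightarrow> G \<in> laurent I \<Longrightarrow> (\<lambda>x. F x + G x) \<in> laurent I"
| mult: "F \<in> laurent I \<Longrightarrow> G \<in> laurent I \<Longrightarrow> (\<lambda>x. F x * G x) \<in> laurent I"

lemma laurent_minus: "F \<in> laurent I \<Longrightarrow> (\<lambda>x. - F x) \<in> laurent I"
  using laurent.mult[OF laurent.const[of "-1"]] by simp

lemma laurent_diff: "F \<in> laurent I \<Longrightarrow> G \<in> laurent I \<Longrightarrow> (\<lambda>x. F x - G x) \<in> laurent I"
  using laurent.add[OF _ laurent_minus] by simp

lemma laurent_power: "F \<in> laurent I \<Longrightarrow> (\<lambda>x. F x ^ n) \<in> laurent I"
  by (induction n) (auto intro: laurent.intros)

lemma laurent_sum: "(\<And>i. i \<in> A \<Longrightarrow> F i \<in> laurent I) \<Longrightarrow> (\<lambda>x. \<Sum>i\<in>A. F i x) \<in> laurent I"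
  by (induction A rule: infinite_finite_induct) (auto intro: laurent.intros)

lemma laurent_prod: "(\<And>i. i \<in> A \<Longrightarrow> F i \<in> laurent I) \<Longrightarrow> (\<lambda>x. \<Prod>i\<in>A. F i x) \<in> laurent I"
  by (induction A rule: infinite_finite_induct) (auto intro: laurent.intros)

lemmas laurent_intros =
  laurent.intros laurent_minus laurent_diff laurent_power laurent_sum laurent_prod

lemma laurent_compose:
  assumes "F \<in> laurent I"
    and "\<And>i. (\<lambda>x. G x i) \<in> laurent J" "\<And>i. i \<in> I \<Longrightarrow> (\<lambda>x. inverse (G x i)) \<in> laurent J"
  shows "(\<lambda>x. F (G x)) \<in> laurent J"
  using assms(1) by (induction rule: laurent.induct) (auto intro: laurent.intros assms)

lemma laurent_update:
  assumes "F \<in> laurent I" "\<tau> \<in> laurent I" "\<zeta> \<in> I \<Longrightarrow> (\<lambda>x. inverse (\<tau> x)) \<in> laurent I"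
  shows "(\<lambda>x. F (x(\<zeta> := \<tau> x))) \<in> laurent I"
proof (rule laurent_compose[OF assms(1)])
  show "(\<lambda>x. (x(\<zeta> := \<tau> x)) i) \<in> laurent I" for i
    by (cases "i = \<zeta>") (auto intro: laurent.intros assms)
  show "(\<lambda>x. inverse ((x(\<zeta> := \<tau> x)) i)) \<in> laurent I" if "i \<in> I" for i
    using that by (cases "i = \<zeta>") (auto intro: laurent.intros assms)
qed

text \<open>The factor theorem in the variable \<zeta>: 1/x - 1/\<tau> is -(x - \<tau>)/(x \<tau>),
  and products telescope. The first rule fails for the default value \<open>inverse 0 = 0\<close>,
  hence the nonvanishing conditions. Below, \<tau> is either the root of an exchange polynomial or
  0.\<close>

lemma laurent_update_factor:
  assumes F: "F \<in> laurent I" and \<tau>: "\<tau> \<in> laurent I" "\<zeta> \<in> I \<Longrightarrow> (\<lambda>x. inverse (\<tau> x)) \<in> laurent I"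
  shows "\<exists>H\<in>laurent I. \<forall>x. (\<forall>i\<in>I. x i \<noteq> 0) \<longrightarrow> (\<zeta> \<in> I \<longrightarrow> \<tau> x \<noteq> 0) \<longrightarrow>
    F x - F (x(\<zeta> := \<tau> x)) = (x \<zeta> - \<tau> x) * H x"
  using F
proof (induction rule: laurent.induct)
  case (const c)
  show ?case by (rule bexI[of _ "\<lambda>x. 0"]) (auto intro: laurent.intros)
next
  case (var i)
  show ?case
    by (rule bexI[of _ "\<lambda>x. if i = \<zeta> then 1 else 0"]) (auto intro: laurent.intros)
next
  case (inv i)
  show ?case
  proof (cases "i = \<zeta>")
    case True
    have "(\<lambda>x. - (inverse (x \<zeta>) * inverse (\<tau> x))) \<in> laurent I"
      using inv \<tau> True by (intro laurent_intros) auto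
    then show ?thesis using True inv
      by (intro bexI[of _ "\<lambda>x. - (inverse (x \<zeta>) * inverse (\<tau> x))"]) (auto simp: field_simps)
  qed (auto intro!: bexI[of _ "\<lambda>x. 0"] laurent.intros)
next
  case (add F G)
  then obtain H K where HK: "H \<in> laurent I" "K \<in> laurent I"
    "\<forall>x. (\<forall>i\<in>I. x i \<noteq> 0) \<longrightarrow> (\<zeta> \<in> I \<longrightarrow> \<tau> x \<noteq> 0) \<longrightarrow>
      F x - F (x(\<zeta> := \<tau> x)) = (x \<zeta> - \<tau> x) * H x"
    "\<forall>x. (\<forall>i\<in>I. x i \<noteq> 0) \<longrightarrow> (\<zeta> \<in> I \<longrightarrow> \<tau> x \<noteq> 0) \<longrightarrow>
      G x - G (x(\<zeta> := \<tau> x)) = (x \<zeta> - \<tau> x) * K x" by blast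
  have "F x + G x - (F (x(\<zeta> := \<tau> x)) + G (x(\<zeta> := \<tau> x))) = (x \<zeta> - \<tau> x) * (H x + K x)"
    if "\<forall>i\<in>I. x i \<noteq> 0" "\<zeta> \<in> I \<longrightarrow> \<tau> x \<noteq> 0" for x
  proof -
    have "F x - F (x(\<zeta> := \<tau> x)) = (x \<zeta> - \<tau> x) * H x" "G x - G (x(\<zeta> := \<tau> x)) = (x \<zeta> - \<tau> x) * K x"
      using HK(3,4) that by blast+
    then show ?thesis by (simp only: distrib_left add_diff_add)
  qed
  moreover have "(\<lambda>x. H x + K x) \<in> laurent I" by (intro laurent.add HK)
  ultimately show ?case
    by - (rule bexI[of _ "\<lambda>x. H x + K x"], intro allI impI, blast)
next
  case (mult F G)
  then obtain H K where HK: "H \<in> laurent I" "K \<in> laurent I"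
    "\<forall>x. (\<forall>i\<in>I. x i \<noteq> 0) \<longrightarrow> (\<zeta> \<in> I \<longrightarrow> \<tau> x \<noteq> 0) \<longrightarrow>
      F x - F (x(\<zeta> := \<tau> x)) = (x \<zeta> - \<tau> x) * H x"
    "\<forall>x. (\<forall>i\<in>I. x i \<noteq> 0) \<longrightarrow> (\<zeta> \<in> I \<longrightarrow> \<tau> x \<noteq> 0) \<longrightarrow>
      G x - G (x(\<zeta> := \<tau> x)) = (x \<zeta> - \<tau> x) * K x" by blast
  have "F x * G x - F (x(\<zeta> := \<tau> x)) * G (x(\<zeta> := \<tau> x))
      = (x \<zeta> - \<tau> x) * (H x * G x + F (x(\<zeta> := \<tau> x)) * K x)"
    if "\<forall>i\<in>I. x i \<noteq> 0" "\<zeta> \<in> I \<longrightarrow> \<tau> x \<noteq> 0" for x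
  proof -
    have "F x - F (x(\<zeta> := \<tau> x)) = (x \<zeta> - \<tau> x) * H x" "G x - G (x(\<zeta> := \<tau> x)) = (x \<zeta> - \<tau> x) * K x"
      using HK(3,4) that by blast+
    moreover have "F x * G x - F (x(\<zeta> := \<tau> x)) * G (x(\<zeta> := \<tau> x))
      = (F x - F (x(\<zeta> := \<tau> x))) * G x + F (x(\<zeta> := \<tau> x)) * (G x - G (x(\<zeta> := \<tau> x)))"
      by (simp add: left_diff_distrib right_diff_distrib)
    ultimately show ?thesis by (simp only: distrib_left mult.assoc mult.left_commute)
  qed
  moreover have "(\<lambda>x. H x * G x + F (x(\<zeta> := \<tau> x)) * K x) \<in> laurent I"
    by (intro laurent_intros laurent_update HK mult \<tau>)
  ultimately show ?case
    by - (rule bexI[of _ "\<lambda>x. H x * G x + F (x(\<zeta> := \<tau> x)) * K x"], intro allI impI, blast)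
qed

text \<open>The segment joining \<open>a\<close> to \<open>b\<close> reduces statements about Laurent polynomial functions to
  polynomials in one variable.\<close>

definition segment :: "(nat \<Rightarrow> real) \<Rightarrow> (nat \<Rightarrow> real) \<Rightarrow> real \<Rightarrow> nat \<Rightarrow> real" where
  "segment a b s = (\<lambda>i. a i + s * (b i - a i))"

lemma segment_simps [simp]: "segment a b 0 = a" "segment a b 1 = b"
  by (auto simp: segment_def)

text \<open>The segment may cross coordinate hyperplanes, where an inverted coordinate takes the
  default value 0; such parameters are among the roots of \<open>q\<close>. The two ends are not,
  because \<open>a\<close> and \<open>b\<close> have no zero coordinate.\<close>

lemma laurent_on_segment:
  assumes "F \<in> laurent I" "\<forall>i. a i \<noteq> 0" "\<forall>i. b i \<noteq> 0"
  shows "\<exists>p q. poly q 0 \<noteq> 0 \<and> poly q 1 \<noteq> 0 \<and>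
    (\<forall>s. poly q s \<noteq> 0 \<longrightarrow> F (segment a b s) * poly q s = poly p s)"
  using assms(1)
proof (induction rule: laurent.induct)
  case (const c)
  show ?case by (rule exI[of _ "[:c:]"], rule exI[of _ 1]) auto
next
  case (var i)
  show ?case
    by (rule exI[of _ "[:a i, b i - a i:]"], rule exI[of _ 1]) (auto simp: segment_def)
next
  case (inv i)
  show ?case using assms
    by (intro exI[of _ 1] exI[of _ "[:a i, b i - a i:]"]) (auto simp: segment_def)
next
  case (add F G)
  then obtain p q p' q' where *: "poly q 0 \<noteq> 0" "poly q 1 \<noteq> 0" "poly q' 0 \<noteq> 0" "poly q' 1 \<noteq> 0"
    "\<forall>s. poly q s \<noteq> 0 \<longrightarrow> F (segment a b s) * poly q s = poly p s"
    "\<forall>s. poly q' s \<noteq> 0 \<longrightarrow> G (segment a b s) * poly q' s = poly p' s" by blast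
  then show ?case
    by (intro exI[of _ "p * q' + p' * q"] exI[of _ "q * q'"])
      (auto simp: algebra_simps simp flip: *(5,6))
next
  case (mult F G)
  then obtain p q p' q' where *: "poly q 0 \<noteq> 0" "poly q 1 \<noteq> 0" "poly q' 0 \<noteq> 0" "poly q' 1 \<noteq> 0"
    "\<forall>s. poly q s \<noteq> 0 \<longrightarrow> F (segment a b s) * poly q s = poly p s"
    "\<forall>s. poly q' s \<noteq> 0 \<longrightarrow> G (segment a b s) * poly q' s = poly p' s" by blast
  then show ?case
    by (intro exI[of _ "p * p'"] exI[of _ "q * q'"])
      (auto simp: algebra_simps simp flip: *(5,6))
qed

lemma poly_zero_if_zero_on_interval:
  fixes p :: "real poly"
  assumes "a < b" "\<And>s. a < s \<Longrightarrow> s < b \<Longrightarrow> poly p s = 0"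
  shows "p = 0"
proof (rule ccontr)
  assume "p \<noteq> 0"
  then have "finite {s. poly p s = 0}" by (rule poly_roots_finite)
  moreover have "{a<..<b} \<subseteq> {s. poly p s = 0}" using assms by auto
  ultimately have "finite {a<..<b}" by (rule rev_finite_subset)
  then show False using assms(1) infinite_Ioo by blast
qed

text \<open>A polynomial in one variable that vanishes on an interval is zero. This leads from
  positive vectors to vectors with negative coordinates, where exchange polynomials can
  vanish.\<close>

lemma laurent_identity:
  assumes F: "F \<in> laurent I" and zero: "\<And>x. \<forall>i. x i > 0 \<Longrightarrow> F x = 0" and b: "\<forall>i. b i \<noteq> 0"
  shows "F b = 0"
proof -
  \<comment> \<open>On the way from |b| to b a negative coordinate is |b i| (1 - 2 s), so the first
    half of the segment stays positive.\<close>
  define a where "a = (\<lambda>i. \<bar>b i\<bar>)"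
  have a: "\<forall>i. a i \<noteq> 0" using b by (auto simp: a_def)
  obtain p q where pq: "poly q 0 \<noteq> 0" "poly q 1 \<noteq> 0"
    "\<And>s. poly q s \<noteq> 0 \<Longrightarrow> F (segment a b s) * poly q s = poly p s"
    using laurent_on_segment[OF F a b] by blast
  have "poly (p * q) s = 0" if "0 < s" "s < 1/2" for s
  proof -
    have "segment a b s i > 0" for i
    proof (cases "b i > 0")
      case False
      then have "segment a b s i = - b i * (1 - 2 * s)" using b[rule_format, of i]
        by (simp add: segment_def a_def algebra_simps)
      moreover have "- b i > 0" using False b[rule_format, of i] by linarith
      moreover have "1 - 2 * s > 0" using that by simp
      ultimately show ?thesis by (simp only: mult_pos_pos)
    qed (simp add: segment_def a_def)
    then have "F (segment a b s) = 0" using zero by blast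
    then show ?thesis using pq(3)[of s] by auto
  qed
  then have "p * q = 0" by (intro poly_zero_if_zero_on_interval[of 0 "1/2"]) auto
  then have "p = 0" using pq by auto
  then show ?thesis using pq(2) pq(3)[of 1] by auto
qed

text \<open>Absence of zero divisors: otherwise both functions are nonzero at some positive point,
  and on the segment between these points a product of nonzero polynomials in one variable would
  vanish. The point \<open>a\<close> certifies that \<open>G\<close> is not the zero
  function.\<close>

lemma laurent_domain:
  assumes F: "F \<in> laurent I" and G: "G \<in> laurent I"
    and zero: "\<And>x. \<forall>i. x i > 0 \<Longrightarrow> F x * G x = 0"
    and a: "\<forall>i. a i \<noteq> 0" "G a \<noteq> 0" and b: "\<forall>i. b i \<noteq> 0"
  shows "F b = 0"
proof (rule ccontr)
  assume "F b \<noteq> 0"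
  then obtain b' where b': "\<forall>i. b' i > 0" "F b' \<noteq> 0" using laurent_identity[OF F _ b] by blast
  obtain a' where a': "\<forall>i. a' i > 0" "G a' \<noteq> 0" using laurent_identity[OF G _ a(1)] a(2) by blast
  have nz: "\<forall>i. a' i \<noteq> 0" "\<forall>i. b' i \<noteq> 0" using a' b' by (metis less_irrefl)+
  obtain p q where pq: "poly q 0 \<noteq> 0" "poly q 1 \<noteq> 0"
    "\<And>s. poly q s \<noteq> 0 \<Longrightarrow> F (segment a' b' s) * poly q s = poly p s"
    using laurent_on_segment[OF F nz] by blast
  obtain p' q' where pq': "poly q' 0 \<noteq> 0" "poly q' 1 \<noteq> 0"
    "\<And>s. poly q' s \<noteq> 0 \<Longrightarrow> G (segment a' b' s) * poly q' s = poly p' s"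
    using laurent_on_segment[OF G nz] by blast
  have "poly (p * p' * q * q') s = 0" if "0 < s" "s < 1" for s
  proof -
    have "segment a' b' s i > 0" for i
    proof -
      have "segment a' b' s i = (1 - s) * a' i + s * b' i" by (simp add: segment_def algebra_simps)
      then show ?thesis using that a' b' by (simp add: add_pos_pos)
    qed
    then have "F (segment a' b' s) * G (segment a' b' s) = 0" using zero by blast
    then show ?thesis using pq(3)[of s] pq'(3)[of s]
      by (cases "poly q s = 0"; cases "poly q' s = 0") auto
  qed
  then have "p * p' * q * q' = 0" by (intro poly_zero_if_zero_on_interval[of 0 1]) auto
  then have "p = 0 \<or> p' = 0" using pq pq' by auto
  then show False using pq(2) pq(3)[of 1] pq'(1) pq'(3)[of 0] a'(2) b'(2) by auto
qed

section \<open>Mutation of tuples and integer matrices\<close>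

text \<open>Seeds are encoded by functions: \<open>M i k\<close> is the entry in row \<open>i < N\<close> and column \<open>k\<close>, and
  \<open>x i\<close> is the variable of row \<open>i\<close>.  Since \<^const>\<open>nat\<close> truncates, \<open>nat (M i k)\<close> is \<open>[M i k]\<^sub>+\<close>.\<close>

definition exchange_poly :: "nat \<Rightarrow> (nat \<Rightarrow> nat \<Rightarrow> int) \<Rightarrow> nat \<Rightarrow> (nat \<Rightarrow> 'a::field) \<Rightarrow> 'a" where
  "exchange_poly N M k x = (\<Prod>i<N. x i ^ nat (M i k)) + (\<Prod>i<N. x i ^ nat (- M i k))"

definition mut_vars :: "nat \<Rightarrow> (nat \<Rightarrow> nat \<Rightarrow> int) \<Rightarrow> nat \<Rightarrow> (nat \<Rightarrow> 'a::field) \<Rightarrow> nat \<Rightarrow> 'a" where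
  "mut_vars N M k x = x(k := exchange_poly N M k x / x k)"

definition mut_mat :: "nat \<Rightarrow> (nat \<Rightarrow> nat \<Rightarrow> int) \<Rightarrow> nat \<Rightarrow> nat \<Rightarrow> int" where
  "mut_mat k M = (\<lambda>i j. if i = k \<or> j = k then - M i j
     else M i j + max (M i k) 0 * max (M k j) 0 - max (- M i k) 0 * max (- M k j) 0)"

fun mut_vars_seq ::
    "nat \<Rightarrow> (nat \<Rightarrow> nat \<Rightarrow> int) \<Rightarrow> nat list \<Rightarrow> (nat \<Rightarrow> 'a::field) \<Rightarrow> nat \<Rightarrow> 'a" where
  "mut_vars_seq N M [] x = x"
| "mut_vars_seq N M (k # w) x = mut_vars_seq N (mut_mat k M) w (mut_vars N M k x)"

definition skew :: "nat \<Rightarrow> (nat \<Rightarrow> nat \<Rightarrow> int) \<Rightarrow> bool" where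
  "skew r M \<longleftrightarrow> (\<exists>d :: nat \<Rightarrow> int. (\<forall>i<r. d i > 0) \<and> (\<forall>i<r. \<forall>j<r. d i * M i j = - (d j * M j i)))"

lemma skew_diag: "skew r M \<Longrightarrow> k < r \<Longrightarrow> M k k = 0"
  unfolding skew_def by (auto dest!: spec[of _ k])

lemma skew_sign:
  assumes "skew r M" "i < r" "j < r"
  shows "M i j > 0 \<longleftrightarrow> M j i < 0" "M i j = 0 \<longleftrightarrow> M j i = 0"
proof -
  obtain d :: "nat \<Rightarrow> int" where d: "d i > 0" "d j > 0" "d i * M i j = - (d j * M j i)"
    using assms unfolding skew_def by blast
  have "M i j > 0 \<longleftrightarrow> d i * M i j > 0" "M i j = 0 \<longleftrightarrow> d i * M i j = 0"
    "M j i < 0 \<longleftrightarrow> d j * M j i < 0" "M j i = 0 \<longleftrightarrow> d j * M j i = 0"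
    using d(1,2) by (auto simp: zero_less_mult_iff mult_less_0_iff)
  then show "M i j > 0 \<longleftrightarrow> M j i < 0" "M i j = 0 \<longleftrightarrow> M j i = 0"
    using d(3) by linarith+
qed

lemma skew_mut_mat:
  assumes "skew r M" "k < r"
  shows "skew r (mut_mat k M)"
proof -
  obtain d :: "nat \<Rightarrow> int" where d: "\<And>i. i < r \<Longrightarrow> d i > 0"
    "\<And>i j. i < r \<Longrightarrow> j < r \<Longrightarrow> d i * M i j = - (d j * M j i)"
    using assms unfolding skew_def by blast
  have max_mult: "c * max a 0 = max (c * a) 0" if "c > 0" for a c :: int
    using that by (simp add: max_def mult_le_0_iff)
  have "d i * (max (M i k) 0 * max (M k j) 0) = d j * (max (- M j k) 0 * max (- M k i) 0)"
    if "i < r" "j < r" for i j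
  proof -
    have "d i * max (M i k) 0 = d k * max (- M k i) 0"
      using max_mult[OF d(1)] d(2)[of i k] that assms(2) by simp
    moreover have "d k * max (M k j) 0 = d j * max (- M j k) 0"
      using max_mult[OF d(1)] d(2)[of k j] that assms(2) by simp
    ultimately show ?thesis by (metis mult.assoc mult.commute)
  qed
  then have "d i * mut_mat k M i j = - (d j * mut_mat k M j i)" if "i < r" "j < r" for i j
    using that d(2)[of i j] by (auto simp: mut_mat_def algebra_simps)
  then show ?thesis unfolding skew_def using d(1) by blast
qed

lemma skew_uminus:
  assumes "skew r M"
  shows "skew r (\<lambda>i j. - M i j)"
proof -
  obtain d :: "nat \<Rightarrow> int" where d: "\<forall>i<r. d i > 0"
    "\<And>i j. i < r \<Longrightarrow> j < r \<Longrightarrow> d i * M i j = - (d j * M j i)"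
    using assms unfolding skew_def by blast
  have "d i * - M i j = - (d j * - M j i)" if "i < r" "j < r" for i j
    using d(2)[OF that] by linarith
  with d(1) show ?thesis unfolding skew_def by blast
qed

lemma mut_mat_uminus: "mut_mat k (\<lambda>i j. - M i j) = (\<lambda>i j. - mut_mat k M i j)"
  by (intro ext) (auto simp: mut_mat_def)

lemma mut_vars_uminus: "mut_vars N (\<lambda>i j. - M i j) k = mut_vars N M k"
  by (intro ext) (auto simp: mut_vars_def exchange_poly_def add.commute)

lemma mut_mat_involution:
  assumes "M k k = 0"
  shows "mut_mat k (mut_mat k M) = M"
  using assms by (intro ext) (auto simp: mut_mat_def)

text \<open>Negating column \<open>k\<close> only swaps the two monomials, and the zero diagonal
  entry hides the variable that mutation changes. This is what makes mutation an involution.\<close>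

lemma exchange_poly_cong:
  assumes "\<And>i. i < N \<Longrightarrow> i \<noteq> k \<Longrightarrow> x i = y i" "M k k = 0" "\<And>i. i < N \<Longrightarrow> M' i k = - M i k"
  shows "exchange_poly N M' k x = exchange_poly N M k y"
proof -
  have "x i ^ nat (M i k) = y i ^ nat (M i k)" "x i ^ nat (- M i k) = y i ^ nat (- M i k)"
    if "i < N" for i
    using assms(1)[OF that] assms(2) by (cases "i = k"; simp)+
  then show ?thesis unfolding exchange_poly_def using assms(3)
    by (subst add.commute) (intro arg_cong2[of _ _ _ _ "(+)"] prod.cong; simp)
qed

lemma mut_vars_involution:
  assumes "M k k = 0" "x k \<noteq> 0" "exchange_poly N M k x \<noteq> 0"
  shows "mut_vars N (mut_mat k M) k (mut_vars N M k x) = x"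
proof -
  have "exchange_poly N (mut_mat k M) k (mut_vars N M k x) = exchange_poly N M k x"
    by (rule exchange_poly_cong) (auto simp: mut_vars_def mut_mat_def assms)
  then show ?thesis using assms by (intro ext) (auto simp: mut_vars_def)
qed

lemma exchange_poly_pos:
  fixes x :: "nat \<Rightarrow> real"
  shows "\<forall>i. x i > 0 \<Longrightarrow> exchange_poly N M k x > 0"
  unfolding exchange_poly_def by (intro add_pos_pos prod_pos) auto

lemma mut_vars_pos:
  fixes x :: "nat \<Rightarrow> real"
  shows "\<forall>i. x i > 0 \<Longrightarrow> mut_vars N M k x i > 0"
  by (simp add: mut_vars_def exchange_poly_pos)

lemma mut_vars_seq_pos:
  fixes x :: "nat \<Rightarrow> real"
  shows "\<forall>i. x i > 0 \<Longrightarrow> mut_vars_seq N M w x j > 0"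
  by (induction w arbitrary: M x) (auto simp: mut_vars_pos)

text \<open>Entries in old rows never depend on the new row, since every pivot \<open>k\<close>
  satisfies k < r \<le> N; so the new row acts only through powers of \<open>x N\<close>.\<close>

lemma mut_vars_seq_new_row:
  fixes x :: "nat \<Rightarrow> 'a::field"
  assumes "\<And>i j. i < N \<Longrightarrow> M' i j = M i j" "set w \<subseteq> {..<r}" "r \<le> N"
  shows "x N = 1 \<Longrightarrow> mut_vars_seq (Suc N) M' w x = mut_vars_seq N M w x"
  using assms
proof (induction w arbitrary: M M' x)
  case (Cons k w)
  then have "k < N" by auto
  then have "mut_mat k M' i j = mut_mat k M i j" if "i < N" for i j
    using Cons.prems that by (auto simp: mut_mat_def)
  moreover have "mut_vars (Suc N) M' k x = mut_vars N M k x"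
    using Cons.prems by (auto simp: mut_vars_def exchange_poly_def intro!: ext)
  moreover have "mut_vars N M k x N = 1" using Cons.prems \<open>k < N\<close> by (simp add: mut_vars_def)
  ultimately show ?case using Cons.IH[of "mut_vars N M k x" "mut_mat k M'" "mut_mat k M"] Cons.prems
    by simp
qed simp

lemma mut_vars_seq_update_unused:
  assumes "set w \<subseteq> {..<N}"
  shows "mut_vars_seq N M w (x(N := c)) = (mut_vars_seq N M w x)(N := c)"
  using assms
proof (induction w arbitrary: M x)
  case (Cons k w)
  have "mut_vars N M k (x(N := c)) = (mut_vars N M k x)(N := c)"
    using Cons.prems by (auto simp: mut_vars_def exchange_poly_def intro!: ext)
  moreover have "set w \<subseteq> {..<N}" using Cons.prems by simp
  ultimately show ?case by (simp only: mut_vars_seq.simps Cons.IH)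
qed simp

section \<open>The Laurent phenomenon\<close>

lemma laurent_exchange_poly: "exchange_poly N M k \<in> laurent I"
proof -
  have "(\<lambda>x. (\<Prod>i<N. x i ^ nat (M i k)) + (\<Prod>i<N. x i ^ nat (- M i k))) \<in> laurent I"
    by (intro laurent_intros)
  then show ?thesis by (simp add: exchange_poly_def[abs_def])
qed

lemma laurent_inverse_monomial: "(\<lambda>x. inverse (\<Prod>i\<in>A. x i ^ e i)) \<in> laurent UNIV"
proof -
  have "(\<lambda>x. \<Prod>i\<in>A. inverse (x i) ^ e i) \<in> laurent UNIV" by (intro laurent_intros) auto
  then show ?thesis by (simp add: prod_inversef[symmetric] power_inverse o_def)
qed

text \<open>\<open>D\<close> is a common denominator for the inverses of all substituted
  coordinates. A power of it clears the denominators, and the exponents add up under sums and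
  products alike.\<close>

lemma laurent_fraction:
  assumes F: "F \<in> laurent UNIV" and G: "\<And>i. (\<lambda>x. G x i) \<in> laurent UNIV" and D: "D \<in> laurent UNIV"
    and inv: "\<And>i. \<exists>h\<in>laurent UNIV. \<forall>x. (\<forall>i. x i > 0) \<longrightarrow> inverse (G x i) * D x = h x"
  shows "\<exists>f\<in>laurent UNIV. \<exists>n. \<forall>x. (\<forall>i. x i > 0) \<longrightarrow> F (G x) * D x ^ n = f x"
  using F
proof (induction rule: laurent.induct)
  case (const c)
  show ?case by (intro bexI[of _ "\<lambda>x. c"] exI[of _ 0]) (auto intro: laurent.intros)
next
  case (var i)
  show ?case by (intro bexI[of _ "\<lambda>x. G x i"] exI[of _ 0]) (auto intro: G)
next
  case (inv i)
  show ?case using assms(4)[of i] by (metis power_one_right)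
next
  case (add F F')
  then obtain f n f' n' where *: "f \<in> laurent UNIV" "f' \<in> laurent UNIV"
    "\<forall>x. (\<forall>i. x i > 0) \<longrightarrow> F (G x) * D x ^ n = f x"
    "\<forall>x. (\<forall>i. x i > 0) \<longrightarrow> F' (G x) * D x ^ n' = f' x" by blast
  have "(F (G x) + F' (G x)) * D x ^ (n + n') = f x * D x ^ n' + f' x * D x ^ n"
    if "\<forall>i. x i > 0" for x
    using *(3)[rule_format, of x, symmetric] *(4)[rule_format, of x, symmetric] that
    by (simp add: power_add distrib_right)
  moreover have "(\<lambda>x. f x * D x ^ n' + f' x * D x ^ n) \<in> laurent UNIV"
    by (intro laurent_intros * D)
  ultimately show ?case
    by - (rule bexI[of _ "\<lambda>x. f x * D x ^ n' + f' x * D x ^ n"], rule exI[of _ "n + n'"], blast)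
next
  case (mult F F')
  then obtain f n f' n' where *: "f \<in> laurent UNIV" "f' \<in> laurent UNIV"
    "\<forall>x. (\<forall>i. x i > 0) \<longrightarrow> F (G x) * D x ^ n = f x"
    "\<forall>x. (\<forall>i. x i > 0) \<longrightarrow> F' (G x) * D x ^ n' = f' x" by blast
  have "(F (G x) * F' (G x)) * D x ^ (n + n') = f x * f' x" if "\<forall>i. x i > 0" for x
    using *(3)[rule_format, of x, symmetric] *(4)[rule_format, of x, symmetric] that
    by (simp add: power_add)
  moreover have "(\<lambda>x. f x * f' x) \<in> laurent UNIV" by (intro laurent_intros *)
  ultimately show ?case
    by - (rule bexI[of _ "\<lambda>x. f x * f' x"], rule exI[of _ "n + n'"], blast)
qed

text \<open>The exchange polynomial is linear in \<open>x \<zeta>\<close> with a monomial leading coefficient, so setting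
  it to zero amounts to substituting a Laurent monomial (up to sign) for \<open>x \<zeta>\<close>, and the functions
  vanishing after the substitution are its multiples.\<close>

lemma exchange_poly_prime:
  assumes \<zeta>: "\<zeta> < N" "M \<zeta> k = 1"
    and f: "f \<in> laurent UNIV" and D: "D \<in> laurent UNIV" and g: "g \<in> laurent UNIV"
    and eq: "\<And>x. \<forall>i. x i > 0 \<Longrightarrow> f x * D x = exchange_poly N M k x * g x"
    and a: "\<forall>i. a i \<noteq> 0" "exchange_poly N M k a = 0" "D a \<noteq> 0"
  shows "\<exists>h\<in>laurent UNIV. \<forall>x. (\<forall>i. x i > 0) \<longrightarrow> f x = exchange_poly N M k x * h x"
proof -
  define A :: "(nat \<Rightarrow> real) \<Rightarrow> real" where "A x = (\<Prod>i\<in>{..<N}-{\<zeta>}. x i ^ nat (M i k))" for x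
  define B :: "(nat \<Rightarrow> real) \<Rightarrow> real" where "B x = (\<Prod>i\<in>{..<N}-{\<zeta>}. x i ^ nat (- M i k))" for x
  define \<tau> where "\<tau> x = - B x * inverse (A x)" for x
  have nz: "A x \<noteq> 0" "B x \<noteq> 0" "\<tau> x \<noteq> 0" if "\<forall>i. x i \<noteq> 0" for x
    using that by (auto simp: A_def B_def \<tau>_def)
  have ex: "exchange_poly N M k x = x \<zeta> * A x + B x" for x
    unfolding exchange_poly_def A_def B_def using \<zeta> by (simp add: prod.remove[of "{..<N}" \<zeta>])
  have upd: "A (x(\<zeta> := c)) = A x" "B (x(\<zeta> := c)) = B x" for x c
    unfolding A_def B_def by (auto intro!: prod.cong)
  have \<tau>L: "\<tau> \<in> laurent UNIV"
  proof -
    have "(\<lambda>x. - B x * inverse (A x)) \<in> laurent UNIV"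
      unfolding A_def B_def by (intro laurent_intros laurent_inverse_monomial)
    then show ?thesis by (simp add: \<tau>_def[abs_def])
  qed
  have \<tau>iL: "(\<lambda>x. inverse (\<tau> x)) \<in> laurent UNIV"
  proof -
    have "(\<lambda>x. - inverse (B x) * A x) \<in> laurent UNIV"
      unfolding A_def B_def by (intro laurent_intros laurent_inverse_monomial)
    then show ?thesis by (simp add: \<tau>_def[abs_def])
  qed
  \<comment> \<open>For positive \<open>x\<close> the substituted coordinate \<open>\<tau> x\<close>
    is negative, so the identity is first extended beyond positive vectors.\<close>
  have eq': "f x * D x = exchange_poly N M k x * g x" if "\<forall>i. x i \<noteq> 0" for x
  proof -
    have "(\<lambda>x. f x * D x - exchange_poly N M k x * g x) \<in> laurent UNIV"
      using f D g laurent_exchange_poly by (intro laurent_intros)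
    from laurent_identity[OF this _ that] eq show ?thesis by simp
  qed
  have zero: "f (x(\<zeta> := \<tau> x)) = 0" if x: "\<forall>i. x i \<noteq> 0" for x
  proof (rule laurent_domain[of "\<lambda>x. f (x(\<zeta> := \<tau> x))" UNIV "\<lambda>x. D (x(\<zeta> := \<tau> x))"])
    show "(\<lambda>x. f (x(\<zeta> := \<tau> x))) \<in> laurent UNIV" "(\<lambda>x. D (x(\<zeta> := \<tau> x))) \<in> laurent UNIV"
      using f D \<tau>L \<tau>iL by (auto intro: laurent_update)
    show "f (x(\<zeta> := \<tau> x)) * D (x(\<zeta> := \<tau> x)) = 0" if "\<forall>i. x i > 0" for x
    proof -
      have x: "\<forall>i. x i \<noteq> 0" using that by (metis less_irrefl)
      have "exchange_poly N M k (x(\<zeta> := \<tau> x)) = 0"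
        using nz[OF x] by (simp add: ex upd) (simp add: \<tau>_def)
      moreover have "\<forall>i. (x(\<zeta> := \<tau> x)) i \<noteq> 0" using x nz[OF x] by simp
      ultimately show ?thesis using eq' by (metis mult_zero_left)
    qed
    \<comment> \<open>The witness \<open>a\<close> already is a zero of the exchange polynomial, so
      substituting the root leaves it fixed.\<close>
    have "a(\<zeta> := \<tau> a) = a"
    proof -
      have "a \<zeta> * A a + B a = 0" using a ex by simp
      then have "\<tau> a = a \<zeta>" using nz[OF a(1)]
        by (simp add: \<tau>_def field_simps eq_neg_iff_add_eq_0 add.commute)
      then show ?thesis by simp
    qed
    then show "D (a(\<zeta> := \<tau> a)) \<noteq> 0" using a(3) by simp
    show "\<forall>i. a i \<noteq> 0" "\<forall>i. x i \<noteq> 0" by fact+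
  qed
  obtain H where H: "H \<in> laurent UNIV"
    "\<And>x. \<forall>i. x i \<noteq> 0 \<Longrightarrow> f x - f (x(\<zeta> := \<tau> x)) = (x \<zeta> - \<tau> x) * H x"
    using laurent_update_factor[OF f \<tau>L \<tau>iL, of \<zeta>] nz(3) by auto
  have "f x = exchange_poly N M k x * (inverse (A x) * H x)" if "\<forall>i. x i > 0" for x
  proof -
    have x: "\<forall>i. x i \<noteq> 0" using that by (metis less_irrefl)
    have "x \<zeta> - \<tau> x = exchange_poly N M k x * inverse (A x)"
      using nz[OF x] by (simp add: ex \<tau>_def field_simps)
    then show ?thesis using H(2)[OF x] zero[OF x] by simp
  qed
  moreover have "(\<lambda>x. inverse (A x) * H x) \<in> laurent UNIV"
    unfolding A_def by (intro laurent_intros laurent_inverse_monomial H)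
  ultimately show ?thesis by - (rule bexI[of _ "\<lambda>x. inverse (A x) * H x"], blast)
qed

text \<open>Coprimality as a cancellation law: if the exchange polynomial divides f D, it divides f.
  In this form it passes to products and powers without any factorisation theory.\<close>

definition coprime_to_exchange ::
    "nat \<Rightarrow> (nat \<Rightarrow> nat \<Rightarrow> int) \<Rightarrow> nat \<Rightarrow> ((nat \<Rightarrow> real) \<Rightarrow> real) \<Rightarrow> bool" where
  "coprime_to_exchange N M k D \<longleftrightarrow> D \<in> laurent UNIV \<and>
     (\<forall>f\<in>laurent UNIV. \<forall>g\<in>laurent UNIV.
        (\<forall>x. (\<forall>i. x i > 0) \<longrightarrow> f x * D x = exchange_poly N M k x * g x) \<longrightarrow>
        (\<exists>h\<in>laurent UNIV. \<forall>x. (\<forall>i. x i > 0) \<longrightarrow> f x = exchange_poly N M k x * h x))"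

text \<open>The row \<zeta> makes the exchange polynomial prime, so \<open>D\<close> only has to be
  no multiple of it; a zero \<open>a\<close> of the exchange polynomial with
  \<open>D a \<noteq> 0\<close> shows this.\<close>

lemma coprime_to_exchangeI:
  assumes "\<zeta> < N" "M \<zeta> k = 1" "D \<in> laurent UNIV"
    and "\<forall>i. a i \<noteq> 0" "exchange_poly N M k a = 0" "D a \<noteq> 0"
  shows "coprime_to_exchange N M k D"
  unfolding coprime_to_exchange_def
  using assms exchange_poly_prime[of \<zeta> N M k _ D _ a] by blast

lemma coprime_to_exchangeD:
  assumes D: "coprime_to_exchange N M k D" and f: "f \<in> laurent UNIV" and g: "g \<in> laurent UNIV"
    and eq: "\<And>x. \<forall>i. x i > 0 \<Longrightarrow> f x * D x = exchange_poly N M k x * g x"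
  shows "\<exists>h\<in>laurent UNIV. \<forall>x. (\<forall>i. x i > 0) \<longrightarrow> f x = exchange_poly N M k x * h x"
  using D[unfolded coprime_to_exchange_def, THEN conjunct2, rule_format, OF f g] eq by simp

lemma coprime_to_exchange_mult:
  assumes D: "coprime_to_exchange N M k D" "coprime_to_exchange N M k D'"
  shows "coprime_to_exchange N M k (\<lambda>x. D x * D' x)"
  unfolding coprime_to_exchange_def
proof (intro conjI ballI impI)
  have DL: "D \<in> laurent UNIV" "D' \<in> laurent UNIV" using D by (auto simp: coprime_to_exchange_def)
  then show "(\<lambda>x. D x * D' x) \<in> laurent UNIV" by (intro laurent_intros)
  fix f g assume f: "f \<in> laurent UNIV" and g: "g \<in> laurent UNIV"
    and eq: "\<forall>x. (\<forall>i. x i > 0) \<longrightarrow> f x * (D x * D' x) = exchange_poly N M k x * g x"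
  have "(\<lambda>x. f x * D x) \<in> laurent UNIV" using f DL by (intro laurent_intros)
  from coprime_to_exchangeD[OF D(2) this g]
  obtain h where h: "h \<in> laurent UNIV" "\<forall>x. (\<forall>i. x i > 0) \<longrightarrow> f x * D x = exchange_poly N M k x * h x"
    using eq by (auto simp: mult.assoc)
  show "\<exists>h\<in>laurent UNIV. \<forall>x. (\<forall>i. x i > 0) \<longrightarrow> f x = exchange_poly N M k x * h x"
    by (rule coprime_to_exchangeD[OF D(1) f h(1)]) (use h(2) in simp)
qed

lemma coprime_to_exchange_power:
  assumes "coprime_to_exchange N M k D"
  shows "coprime_to_exchange N M k (\<lambda>x. D x ^ n)"
proof (induction n)
  case 0
  show ?case by (auto simp: coprime_to_exchange_def intro: laurent.intros)
next
  case (Suc n)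
  then show ?case using coprime_to_exchange_mult[OF assms Suc.IH] by simp
qed

lemma coprime_to_exchange_cancel_power:
  assumes D: "coprime_to_exchange N M k D"
    and "f \<in> laurent UNIV" "g \<in> laurent UNIV"
    and "\<And>x. \<forall>i. x i > 0 \<Longrightarrow> f x * D x = exchange_poly N M k x ^ n * g x"
  shows "\<exists>h\<in>laurent UNIV. \<forall>x. (\<forall>i. x i > 0) \<longrightarrow> f x = exchange_poly N M k x ^ n * h x"
  using assms(2-)
proof (induction n arbitrary: f)
  case 0
  then show ?case by (intro bexI[of _ f]) auto
next
  case (Suc n)
  let ?e = "exchange_poly N M k"
  have "(\<lambda>x. ?e x ^ n * g x) \<in> laurent UNIV"
    using Suc.prems laurent_exchange_poly by (intro laurent_intros)
  from coprime_to_exchangeD[OF D Suc.prems(1) this]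
  obtain h where h: "h \<in> laurent UNIV" "\<And>x. \<forall>i. x i > 0 \<Longrightarrow> f x = ?e x * h x"
    using Suc.prems(3) by (auto simp: mult.assoc)
  have "h x * D x = ?e x ^ n * g x" if "\<forall>i. x i > 0" for x
    using Suc.prems(3)[OF that] h(2)[OF that] exchange_poly_pos[OF that, of N M k] by simp
  then obtain h' where "h' \<in> laurent UNIV" "\<And>x. \<forall>i. x i > 0 \<Longrightarrow> h x = ?e x ^ n * h' x"
    using Suc.IH[OF h(1) Suc.prems(2)] by blast
  then show ?case using h(2) by (intro bexI[of _ h']) (auto simp: mult.assoc)
qed

section \<open>Divisibility along the mutation sequence k, m, k\<close>

lemma exchange_poly_split:
  assumes "M m k \<le> 0" "m < N"
  shows "exchange_poly N M k x = (\<Prod>i<N. x i ^ nat (M i k))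
    + x m ^ nat (- M m k) * (\<Prod>i\<in>{..<N}-{m}. x i ^ nat (- M i k))"
  unfolding exchange_poly_def using assms by (simp add: prod.remove[of "{..<N}" m])

lemma prod_update_irrelevant:
  fixes x :: "nat \<Rightarrow> 'a::comm_monoid_mult"
  assumes "e k = 0"
  shows "(\<Prod>i\<in>A. (x(k := c)) i ^ e i) = (\<Prod>i\<in>A. x i ^ e i)"
  using assms by (intro prod.cong) auto

text \<open>Divisibility of the third exchange polynomial \<open>s + y * t\<close> by the first new
  variable \<open>z\<close>. Here \<open>xk * z\<close> is the first exchange polynomial, and
  \<open>y\<close> is a power of the second new variable with numerator \<open>p + u * z\<close>.
  Modulo \<open>z\<close>, \<open>ap\<close> becomes - xm am and \<open>y\<close> becomes p / xm, so
  \<open>s * ap = t * am * p\<close> says that \<open>s + y * t\<close> vanishes.\<close>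

lemma three_step_algebra:
  fixes s :: real
  assumes "ap \<noteq> 0" "xm \<noteq> 0" "s * ap = t * am * p" "xk * z = ap + xm * am" "y = (p + u * z) / xm"
  shows "s + y * t = t * inverse xm * inverse ap * (xk * p + ap * u) * z"
proof -
  have "t * (xk * p + ap * u) * z = t * p * (ap + xm * am) + t * ap * u * z"
    unfolding assms(4)[symmetric] by (simp add: algebra_simps)
  also have "\<dots> = xm * (s * ap) + t * ap * (p + u * z)"
    unfolding assms(3) by (simp add: algebra_simps)
  finally have main: "t * (xk * p + ap * u) * z = xm * (s * ap) + t * ap * (p + u * z)" .
  have "t * inverse xm * inverse ap * (xk * p + ap * u) * z
      = inverse xm * inverse ap * (t * (xk * p + ap * u) * z)" by (simp only: mult_ac)
  also have "\<dots> = inverse xm * inverse ap * (xm * (s * ap) + t * ap * (p + u * z))"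
    by (simp only: main)
  also have "\<dots> = s + y * t" using assms(1,2) by (simp add: assms(5) field_simps)
  finally show ?thesis ..
qed

text \<open>Designed as a zero of the exchange polynomial in direction \<open>k\<close>: an entry of
  absolute value 1 in row \<zeta> turns one monomial into -1, while the other stays 1. The
  coordinate \<open>k\<close> does not occur in that polynomial and remains a free
  parameter.\<close>

definition test_point :: "nat \<Rightarrow> nat \<Rightarrow> real \<Rightarrow> nat \<Rightarrow> real" where
  "test_point \<zeta> k c = (\<lambda>i. 1)(\<zeta> := -1, k := c)"

lemma prod_test_point:
  assumes "e k = 0" "\<zeta> < N" "\<zeta> \<noteq> k"
  shows "(\<Prod>i<N. test_point \<zeta> k c i ^ e i) = (-1) ^ e \<zeta>"
proof -
  have "(\<Prod>i<N. test_point \<zeta> k c i ^ e i)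
      = test_point \<zeta> k c \<zeta> ^ e \<zeta> * (\<Prod>i\<in>{..<N}-{\<zeta>}. test_point \<zeta> k c i ^ e i)"
    using assms by (intro prod.remove) auto
  also have "(\<Prod>i\<in>{..<N}-{\<zeta>}. test_point \<zeta> k c i ^ e i) = 1"
    using assms by (intro prod.neutral) (auto simp: test_point_def)
  finally show ?thesis using assms by (simp add: test_point_def)
qed

lemma exchange_poly_test_point:
  assumes "M k k = 0" "\<bar>M \<zeta> k\<bar> = 1" "\<zeta> < N" "\<zeta> \<noteq> k"
  shows "exchange_poly N M k (test_point \<zeta> k c) = 0"
  unfolding exchange_poly_def using assms
  by (subst (1 2) prod_test_point) (auto simp: abs_if split: if_splits)

text \<open>\<open>y\<close> and \<open>w\<close> are the new variables of the second and third step of the mutation sequence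
  \<open>k, m, k\<close>, as Laurent polynomials in the initial variables; \<open>a\<close> and \<open>a'\<close> witness that neither is
  divisible by the exchange polynomial of the first step.\<close>

definition three_step_laurent :: "nat \<Rightarrow> (nat \<Rightarrow> nat \<Rightarrow> int) \<Rightarrow> nat \<Rightarrow> nat \<Rightarrow> bool" where
  "three_step_laurent N M k m \<longleftrightarrow> (\<exists>y\<in>laurent UNIV. \<exists>w\<in>laurent UNIV.
     (\<forall>x. (\<forall>i. x i > 0) \<longrightarrow>
        mut_vars_seq N M [k, m] x m = y x \<and> mut_vars_seq N M [k, m, k] x k = w x) \<and>
     (\<exists>a. (\<forall>i. a i \<noteq> 0) \<and> exchange_poly N M k a = 0 \<and> y a \<noteq> 0) \<and>
     (\<exists>a'. (\<forall>i. a' i \<noteq> 0) \<and> exchange_poly N M k a' = 0 \<and> w a' \<noteq> 0))"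

text \<open>Negation swaps the monomials of every exchange, so \<open>M k m < 0\<close> reduces to
  the positive case.\<close>

lemma three_step_laurent_uminus:
  "three_step_laurent N (\<lambda>i j. - M i j) k m = three_step_laurent N M k m"
  unfolding three_step_laurent_def
  by (simp add: mut_mat_uminus mut_vars_uminus) (simp add: exchange_poly_def add.commute)

text \<open>For \<open>M k m = 0\<close> the two mutations commute, so the third step undoes the
  first and returns \<open>x k\<close>. Since row \<zeta> is zero in column \<open>m\<close>, the
  second exchange polynomial takes the value 2 at the test point.\<close>

lemma three_step_laurent_zero:
  assumes M: "skew r M" "k < r" "m < r" "k \<noteq> m" "r \<le> \<zeta>" "\<zeta> < N" "\<bar>M \<zeta> k\<bar> = 1" "M \<zeta> m = 0"
    and zero: "M k m = 0"
  shows "three_step_laurent N M k m"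
proof -
  have diag: "M k k = 0" "M m m = 0" "M m k = 0"
    using M zero skew_diag skew_sign(2)[of r M m k] by auto
  define M1 where "M1 = mut_mat k M"
  define M2 where "M2 = mut_mat m M1"
  have M1: "M1 i m = M i m" "M1 i k = - M i k" for i
    using zero M(4) diag by (auto simp: M1_def mut_mat_def)
  have M2: "M2 i k = M i k" if "i \<noteq> i" for i using that by simp
  have M2': "M2 i k = - M i k" for i
    using M(4) diag by (auto simp: M2_def mut_mat_def M1)
  define y where "y x = exchange_poly N M m x * inverse (x m)" for x :: "nat \<Rightarrow> real"
  have step1: "mut_vars N M1 m (mut_vars N M k x) m = y x" for x
  proof -
    have "exchange_poly N M1 m (x(k := c)) = exchange_poly N M m x" for c
      unfolding exchange_poly_def M1 using zero by (simp add: prod_update_irrelevant del: fun_upd_apply)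
    then show ?thesis using M(4) by (simp add: mut_vars_def y_def divide_inverse)
  qed
  have step2: "mut_vars N M2 k (mut_vars N M1 m (mut_vars N M k x)) k = x k"
    if "\<forall>i. x i > 0" for x :: "nat \<Rightarrow> real"
  proof -
    have "exchange_poly N M2 k (x(k := c, m := d)) = exchange_poly N M k x" for c d
      unfolding exchange_poly_def M2' using diag
      by (simp add: prod_update_irrelevant add.commute del: fun_upd_apply)
    then show ?thesis using M(4) that exchange_poly_pos[OF that, of N M k]
      by (simp add: mut_vars_def fun_upd_twist less_imp_neq[symmetric])
  qed
  have "(\<lambda>x. exchange_poly N M m x * inverse (x m)) \<in> laurent UNIV"
    by (intro laurent_intros laurent_exchange_poly) auto
  then have yL: "y \<in> laurent UNIV" by (simp add: y_def[abs_def])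
  define a where "a = test_point \<zeta> k 1"
  have a: "\<forall>i. a i \<noteq> 0" "exchange_poly N M k a = 0" "a k \<noteq> 0" "a m \<noteq> 0"
    using M diag exchange_poly_test_point[of M k \<zeta> N 1] by (auto simp: a_def test_point_def)
  have "exchange_poly N M m a = 2" unfolding exchange_poly_def a_def
    using M zero by (subst (1 2) prod_test_point) auto
  then have "y a \<noteq> 0" using a by (simp add: y_def)
  then show ?thesis
    unfolding three_step_laurent_def using yL laurent.var[of k UNIV] a step1 step2
    by (intro bexI[of _ y] bexI[of _ "\<lambda>x. x k"]) (auto simp flip: M1_def M2_def)
qed

text \<open>Where the first exchange polynomial vanishes, so does the first new variable
  \<open>Z\<close>, and the second one, (P + Z^b Q) / x m, reduces to P / x m, which is not 0. The
  third is Laurent because its exchange polynomial is divisible by \<open>Z\<close>.\<close>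

lemma three_step_laurent_pos:
  assumes M: "skew r M" "k < r" "m < r" "k \<noteq> m" "r \<le> \<zeta>" "\<zeta> < N" "\<bar>M \<zeta> k\<bar> = 1"
    and pos: "M k m > 0"
  shows "three_step_laurent N M k m"
proof -
  have diag: "M k k = 0" "M m m = 0" "M m k < 0"
    using M pos skew_diag skew_sign(1)[of r M k m] by auto
  have lt: "k < N" "m < N" "\<zeta> \<noteq> k" "\<zeta> \<noteq> m" using M by auto
  define M1 where "M1 = mut_mat k M"
  define M2 where "M2 = mut_mat m M1"
  have sk: "skew r M1" "skew r M2" using M by (auto simp: M1_def M2_def intro: skew_mut_mat)
  define b where "b = nat (M k m)"
  define c where "c = nat (- M m k)"
  have bc: "b > 0" "c > 0" "M k m = int b" "M m k = - int c"
    using pos diag by (auto simp: b_def c_def)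
  have M1: "M1 k m = - int b" "M1 m m = 0" "M1 m k = int c" "M1 i k = - M i k" for i
    using sk(1) M skew_diag bc by (auto simp: M1_def mut_mat_def)
  have M2: "M2 k k = 0" "M2 m k = - int c"
    using sk(2) M skew_diag bc M1 by (auto simp: M2_def mut_mat_def)
  have M2': "M2 i k = - M i k + max (M1 i m) 0 * int c" if "i \<noteq> m" for i
    using that M(4) M1 bc by (auto simp: M2_def mut_mat_def)
  \<comment> \<open>In the initial variables the three exchange polynomials read A + (x m)^c A', P +
    Z^b Q and S + y^c T.\<close>
  define Z where "Z x = exchange_poly N M k x * inverse (x k)" for x :: "nat \<Rightarrow> real"
  define P where "P x = (\<Prod>i<N. x i ^ nat (M1 i m))" for x :: "nat \<Rightarrow> real"
  define Q where "Q x = (\<Prod>i\<in>{..<N}-{k}. x i ^ nat (- M1 i m))" for x :: "nat \<Rightarrow> real"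
  define A where "A x = (\<Prod>i<N. x i ^ nat (M i k))" for x :: "nat \<Rightarrow> real"
  define A' where "A' x = (\<Prod>i\<in>{..<N}-{m}. x i ^ nat (- M i k))" for x :: "nat \<Rightarrow> real"
  define S where "S x = (\<Prod>i<N. x i ^ nat (M2 i k))" for x :: "nat \<Rightarrow> real"
  define T where "T x = (\<Prod>i\<in>{..<N}-{m}. x i ^ nat (- M2 i k))" for x :: "nat \<Rightarrow> real"
  \<comment> \<open>\<open>G\<close> is the quotient of (P + Z^b Q)^c - P^c by Z^b Q.\<close>
  define G where "G x = (\<Sum>i<c. P x ^ (c - Suc i) * (P x + Z x ^ b * Q x) ^ i)"
    for x :: "nat \<Rightarrow> real"
  define y where "y x = (P x + Z x ^ b * Q x) * inverse (x m)" for x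
  define w where "w x = T x * inverse (x m ^ c) * inverse (A x)
    * (x k * P x ^ c + A x * (Z x ^ (b - 1) * Q x * G x))" for x
  have ex0: "exchange_poly N M k x = A x + x m ^ c * A' x" for x
    using exchange_poly_split[of M m k N x] diag lt by (simp add: A_def A'_def c_def)
  have ex1: "exchange_poly N M1 m (x(k := Z x)) = P x + Z x ^ b * Q x" for x
  proof -
    have "exchange_poly N M1 m (x(k := Z x)) = (\<Prod>i<N. (x(k := Z x)) i ^ nat (M1 i m))
       + Z x ^ b * (\<Prod>i\<in>{..<N}-{k}. (x(k := Z x)) i ^ nat (- M1 i m))"
      using exchange_poly_split[of M1 k m N "x(k := Z x)"] M1 lt by simp
    also have "(\<Prod>i\<in>{..<N}-{k}. (x(k := Z x)) i ^ nat (- M1 i m)) = Q x"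
      unfolding Q_def by (intro prod.cong) auto
    finally show ?thesis using M1 by (simp add: P_def prod_update_irrelevant del: fun_upd_apply)
  qed
  have ex2: "exchange_poly N M2 k (x(k := z, m := v)) = S x + v ^ c * T x" for x z v
  proof -
    have "exchange_poly N M2 k (x(k := z, m := v)) = (\<Prod>i<N. (x(k := z, m := v)) i ^ nat (M2 i k))
       + v ^ c * (\<Prod>i\<in>{..<N}-{m}. (x(k := z, m := v)) i ^ nat (- M2 i k))"
      using exchange_poly_split[of M2 m k N "x(k := z, m := v)"] M2 lt by simp
    also have "(\<Prod>i\<in>{..<N}-{m}. (x(k := z, m := v)) i ^ nat (- M2 i k)) = T x"
      unfolding T_def using M2 by (intro prod.cong) auto
    finally show ?thesis using M2 by (simp add: S_def prod_update_irrelevant del: fun_upd_apply)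
  qed
  \<comment> \<open>The exponents agree row by row, because mutation at \<open>m\<close> adds
    \<open>c\<close> times the positive part of column \<open>m\<close> to the negated column
    \<open>k\<close>. Modulo \<open>Z\<close> this identity makes S + y^c T vanish.\<close>
  have SA: "S x * A x = T x * A' x * P x ^ c" for x
  proof -
    have rem: "(\<Prod>i<N. x i ^ e i) = (\<Prod>i\<in>{..<N}-{m}. x i ^ e i)" if "e m = 0" for e :: "nat \<Rightarrow> nat"
      using that lt by (simp add: prod.remove[of "{..<N}" m])
    have "x i ^ nat (M2 i k) * x i ^ nat (M i k)
        = x i ^ nat (- M2 i k) * x i ^ nat (- M i k) * (x i ^ nat (M1 i m)) ^ c" if "i \<noteq> m" for i
    proof -
      have "int (nat (M2 i k) + nat (M i k)) = int (nat (- M2 i k) + nat (- M i k) + nat (M1 i m) * c)"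
        using M2'[OF that] by (auto simp: max_def int_nat_eq split: if_splits)
      then have "nat (M2 i k) + nat (M i k) = nat (- M2 i k) + nat (- M i k) + nat (M1 i m) * c"
        by (simp only: of_nat_eq_iff)
      then show ?thesis by (simp only: flip: power_add power_mult)
    qed
    then show ?thesis unfolding S_def A_def T_def A'_def P_def using M2 diag M1
      by (simp add: rem prod_power_distrib flip: prod.distrib)
  qed
  have step1: "mut_vars N M1 m (mut_vars N M k x) = x(k := Z x, m := y x)" for x
    using M(4) ex1[of x] by (intro ext) (simp add: mut_vars_def y_def Z_def divide_inverse)
  have step2: "mut_vars N M2 k (x(k := Z x, m := y x)) k = w x" if x: "\<forall>i. x i > 0" for x
  proof -
    have "x i \<noteq> 0" for i using x by (metis less_irrefl)
    then have nz: "A x \<noteq> 0" "x m ^ c \<noteq> 0" "x k \<noteq> 0" by (simp_all add: A_def)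
    have "(P x + Z x ^ b * Q x) ^ c - P x ^ c = Z x ^ b * Q x * G x"
      using power_diff_sumr2[of "P x + Z x ^ b * Q x" c "P x"] by (simp add: G_def)
    moreover have "Z x ^ b = Z x ^ (b - 1) * Z x" using bc by (metis power_minus_mult)
    ultimately have "(P x + Z x ^ b * Q x) ^ c = P x ^ c + Z x ^ (b - 1) * Q x * G x * Z x"
      by (simp add: algebra_simps)
    then have yc: "y x ^ c = (P x ^ c + Z x ^ (b - 1) * Q x * G x * Z x) / x m ^ c"
      by (simp add: y_def power_mult_distrib power_inverse divide_inverse)
    have "x k * Z x = A x + x m ^ c * A' x" using nz by (simp add: Z_def ex0)
    from three_step_algebra[OF nz(1,2) SA this yc]
    have "S x + y x ^ c * T x = w x * Z x" by (simp add: w_def)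
    moreover have "Z x > 0" using x exchange_poly_pos[OF x] by (simp add: Z_def)
    ultimately show ?thesis using M(4) by (simp add: mut_vars_def ex2)
  qed
  have L: "P \<in> laurent UNIV" "Q \<in> laurent UNIV" "A \<in> laurent UNIV" "T \<in> laurent UNIV"
    "(\<lambda>x. inverse (A x)) \<in> laurent UNIV"
    unfolding P_def[abs_def] Q_def[abs_def] A_def[abs_def] T_def[abs_def]
    by (intro laurent_intros laurent_inverse_monomial)+
  have ZL: "Z \<in> laurent UNIV"
    unfolding Z_def[abs_def] by (intro laurent_intros laurent_exchange_poly) auto
  have yL: "y \<in> laurent UNIV"
    unfolding y_def[abs_def] by (intro laurent_intros L ZL) auto
  have GL: "G \<in> laurent UNIV"
    unfolding G_def[abs_def] by (intro laurent_intros L ZL)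
  have "(\<lambda>x. T x * inverse (x m) ^ c * inverse (A x)
    * (x k * P x ^ c + A x * (Z x ^ (b - 1) * Q x * G x))) \<in> laurent UNIV"
    by (intro laurent_intros L ZL GL) auto
  then have wL: "w \<in> laurent UNIV" by (simp add: w_def[abs_def] power_inverse)
  define pt where "pt = test_point \<zeta> k"
  have pt: "\<forall>i. pt \<kappa> i \<noteq> 0" "exchange_poly N M k (pt \<kappa>) = 0" "Z (pt \<kappa>) = 0"
    "pt \<kappa> m = 1" "pt \<kappa> k = \<kappa>" if "\<kappa> \<noteq> 0" for \<kappa>
    using M diag lt that exchange_poly_test_point[of M k \<zeta> N \<kappa>]
    by (auto simp: pt_def test_point_def Z_def)
  have nz: "P x \<noteq> 0" "T x \<noteq> 0" "A x \<noteq> 0" if "\<forall>i. x i \<noteq> 0" for x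
    using that by (auto simp: P_def T_def A_def)
  have y1: "y (pt 1) \<noteq> 0" using pt[of 1] nz(1)[of "pt 1"] bc by (simp add: y_def zero_power)
  \<comment> \<open>At these zeros of \<open>Z\<close> the last factor of \<open>w\<close> is
    \<kappa> P^c plus a term independent of \<kappa>, which may survive when b = 1. Hence
    \<open>w\<close> vanishes for at most one \<kappa>, and two values suffice.\<close>
  have "w (pt 1) \<noteq> 0 \<or> w (pt 2) \<noteq> 0"
  proof (rule ccontr)
    define u where "u \<kappa> = A (pt \<kappa>) * (Z (pt \<kappa>) ^ (b - 1) * Q (pt \<kappa>) * G (pt \<kappa>))" for \<kappa>
    have upd: "pt 2 = (pt 1)(k := 2)" by (auto simp: pt_def test_point_def)
    have P: "P (pt 2) = P (pt 1)" "A (pt 2) = A (pt 1)"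
      unfolding P_def A_def upd using M1 diag by (auto simp: prod_update_irrelevant simp del: fun_upd_apply)
    have Q: "Q (pt 2) = Q (pt 1)" unfolding Q_def upd by (intro prod.cong) auto
    have "u 2 = u 1" using pt[of 1] pt[of 2] bc by (simp add: u_def P Q G_def)
    assume "\<not> (w (pt 1) \<noteq> 0 \<or> w (pt 2) \<noteq> 0)"
    then have "1 * P (pt 1) ^ c + u 1 = 0" "2 * P (pt 2) ^ c + u 2 = 0"
      using pt[of 1] pt[of 2] nz(2,3)[of "pt 1"] nz(2,3)[of "pt 2"] by (auto simp: w_def u_def)
    then have "P (pt 1) ^ c = 0" by (simp only: \<open>u 2 = u 1\<close> P)
    then show False using nz(1)[of "pt 1"] pt[of 1] by simp
  qed
  then obtain \<kappa> where "\<kappa> \<noteq> 0" "w (pt \<kappa>) \<noteq> 0" by (metis zero_neq_one zero_neq_numeral)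
  then have w1: "\<exists>a. (\<forall>i. a i \<noteq> 0) \<and> exchange_poly N M k a = 0 \<and> w a \<noteq> 0"
    using pt(1,2) by blast
  have y2: "\<exists>a. (\<forall>i. a i \<noteq> 0) \<and> exchange_poly N M k a = 0 \<and> y a \<noteq> 0"
    using pt(1,2)[of 1] y1 by auto
  have "mut_vars_seq N M [k, m] x m = y x \<and> mut_vars_seq N M [k, m, k] x k = w x"
    if "\<forall>i. x i > 0" for x
    using step1[of x] step2[OF that] by (simp flip: M1_def M2_def)
  then show ?thesis unfolding three_step_laurent_def using yL wL y2 w1 by blast
qed

lemma three_step_laurent:
  assumes "skew r M" "k < r" "m < r" "k \<noteq> m" "r \<le> \<zeta>" "\<zeta> < N" "\<bar>M \<zeta> k\<bar> = 1" "M \<zeta> m = 0"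
  shows "three_step_laurent N M k m"
proof -
  consider "M k m = 0" | "M k m > 0" | "M k m < 0" by linarith
  then show ?thesis
  proof cases
    case 3
    with assms have "three_step_laurent N (\<lambda>i j. - M i j) k m"
      by (intro three_step_laurent_pos[of r _ k m \<zeta>] skew_uminus) auto
    then show ?thesis by (simp only: three_step_laurent_uminus)
  qed (use assms three_step_laurent_zero three_step_laurent_pos in blast)+
qed

text \<open>The induction ranges over all \<open>N\<close> and \<open>M\<close>, because it is
  applied to mutated matrices that carry an additional frozen row.\<close>

theorem laurent_phenomenon:
  assumes "skew r M" "r \<le> N" "set ks \<subseteq> {..<r}" "j < N"
  shows "\<exists>F\<in>laurent UNIV. \<forall>x. (\<forall>i. x i > 0) \<longrightarrow> mut_vars_seq N M ks x j = F x"
  using assms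
proof (induction "length ks" arbitrary: N M ks rule: less_induct)
  case less
  consider "ks = []" | k where "ks = [k]" | k ks' where "ks = k # k # ks'"
    | k m ks' where "ks = k # m # ks'" "k \<noteq> m"
    by (cases ks rule: list.exhaust; cases "tl ks") auto
  then show ?case
  proof cases
    case 1
    then show ?thesis by (intro bexI[of _ "\<lambda>x. x j"]) (auto intro: laurent.intros)
  next
    case (2 k)
    have "(\<lambda>x. if j = k then exchange_poly N M k x * inverse (x k) else x j) \<in> laurent UNIV"
      by (cases "j = k") (auto intro!: laurent_intros laurent_exchange_poly)
    with 2 show ?thesis
      by (intro bexI[of _ "\<lambda>x. if j = k then exchange_poly N M k x * inverse (x k) else x j"])
        (auto simp: mut_vars_def divide_inverse)
  next
    case (3 k ks')
    then have k: "M k k = 0" using less.prems skew_diag by auto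
    have "mut_vars_seq N M ks x = mut_vars_seq N M ks' x" if "\<forall>i. x i > 0" for x :: "nat \<Rightarrow> real"
      using k exchange_poly_pos[OF that, of N M k] that[rule_format, of k]
      by (simp add: 3 mut_mat_involution mut_vars_involution)
    moreover obtain F where "F \<in> laurent UNIV" "\<forall>x. (\<forall>i. x i > 0) \<longrightarrow> mut_vars_seq N M ks' x j = F x"
      using less.hyps[of ks' M N] less.prems 3 by auto
    ultimately show ?thesis by (intro bexI[of _ F]) auto
  next
    case (4 k m ks')
    text \<open>A row for a new frozen variable occurring only in column \<open>k\<close> makes the exchange
      polynomial prime; in the end that variable is specialised to \<open>1\<close>.\<close>
    define N' where "N' = Suc N"
    define M' where "M' = (\<lambda>i j. if i = N then (if j = k then 1 else 0) else M i j)"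
    have km: "k < r" "m < r" "k < N" "m < N" "k \<noteq> m" using less.prems 4 by auto
    have "M' i j = M i j" if "i < r" for i j using that less.prems by (auto simp: M'_def)
    then have sk: "skew r M'" using less.prems(1) unfolding skew_def by metis
    define M1 where "M1 = mut_mat k M'"
    define M2 where "M2 = mut_mat m M1"
    define M3 where "M3 = mut_mat k M2"
    have sk': "skew r M1" "skew r M2" "skew r M3"
      using sk km by (auto simp: M1_def M2_def M3_def intro: skew_mut_mat)
    have three: "three_step_laurent N' M' k m"
      by (rule three_step_laurent[of r _ _ _ N]) (use sk km less.prems in \<open>auto simp: N'_def M'_def\<close>)
    then obtain y w a a' where yw: "y \<in> laurent UNIV" "w \<in> laurent UNIV"
      "\<And>x. \<forall>i. x i > 0 \<Longrightarrow> mut_vars_seq N' M' [k, m] x m = y x"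
      "\<And>x. \<forall>i. x i > 0 \<Longrightarrow> mut_vars_seq N' M' [k, m, k] x k = w x"
      "\<forall>i. a i \<noteq> 0" "exchange_poly N' M' k a = 0" "y a \<noteq> 0"
      "\<forall>i. a' i \<noteq> 0" "exchange_poly N' M' k a' = 0" "w a' \<noteq> 0"
      unfolding three_step_laurent_def by blast
    have cop: "coprime_to_exchange N' M' k y" "coprime_to_exchange N' M' k w"
      using coprime_to_exchangeI[of N N' M' k y a] coprime_to_exchangeI[of N N' M' k w a'] yw
      by (simp_all only: N'_def M'_def) simp_all
    define U where "U x = mut_vars_seq N' M' ks x j" for x :: "nat \<Rightarrow> real"
    define Z where "Z x = exchange_poly N' M' k x * inverse (x k)" for x :: "nat \<Rightarrow> real"
    have ZL: "Z \<in> laurent UNIV"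
      unfolding Z_def[abs_def] by (intro laurent_intros laurent_exchange_poly) auto
    have pos: "Z x > 0" "y x > 0" "w x > 0" if "\<forall>i. x i > 0" for x
      using that exchange_poly_pos[OF that] mut_vars_seq_pos[OF that, of N' M' "[k, m]" m]
        mut_vars_seq_pos[OF that, of N' M' "[k, m, k]" k] yw(3,4)[OF that]
      by (auto simp: Z_def)
    have nz: "Z x \<noteq> 0" "y x \<noteq> 0" "w x \<noteq> 0" if "\<forall>i. x i > 0" for x
      using pos[OF that] by auto
    obtain F1 where F1: "F1 \<in> laurent UNIV"
      "\<And>x. \<forall>i. x i > 0 \<Longrightarrow> mut_vars_seq N' M1 (m # ks') x j = F1 x"
      using less.hyps[of "m # ks'" M1 N'] less.prems 4 sk' by (auto simp: N'_def)
    \<comment> \<open>The sequence \<open>k # ks'\<close> undoes the third step of k, m, k before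
      following \<open>ks'\<close>; so it leads from that seed to the same variable and is shorter
      than \<open>ks\<close>.\<close>
    obtain F3 where F3: "F3 \<in> laurent UNIV"
      "\<And>x. \<forall>i. x i > 0 \<Longrightarrow> mut_vars_seq N' M3 (k # ks') x j = F3 x"
      using less.hyps[of "k # ks'" M3 N'] less.prems 4 sk' by (auto simp: N'_def)
    have U1: "U x = F1 (x(k := Z x))" if "\<forall>i. x i > 0" for x
    proof -
      have "mut_vars N' M' k x = x(k := Z x)" by (simp add: mut_vars_def Z_def divide_inverse)
      then show ?thesis using F1(2)[of "x(k := Z x)"] that pos(1)[OF that]
        by (simp add: U_def 4 M1_def)
    qed
    have U3: "U x = F3 (x(k := w x, m := y x))" if x: "\<forall>i. x i > 0" for x
    proof -
      define x1 where "x1 = mut_vars N' M' k x"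
      define x2 where "x2 = mut_vars N' M1 m x1"
      define x3 where "x3 = mut_vars N' M2 k x2"
      have x2: "\<forall>i. x2 i > 0" using x by (simp add: x1_def x2_def mut_vars_pos)
      have diag: "M2 k k = 0" using sk' km skew_diag by blast
      have "mut_vars_seq N' M3 (k # ks') x3 = mut_vars_seq N' M2 ks' x2"
        using exchange_poly_pos[OF x2, of N' M2 k] x2[rule_format, of k]
        by (simp add: M3_def x3_def mut_mat_involution mut_vars_involution diag)
      then have "U x = mut_vars_seq N' M3 (k # ks') x3 j"
        by (simp add: U_def 4 x1_def x2_def M1_def M2_def)
      moreover have "x3 = x(k := w x, m := y x)"
      proof
        fix i
        show "x3 i = (x(k := w x, m := y x)) i"
          using yw(3,4)[OF x] km
          by (cases "i = k"; cases "i = m") (auto simp: x1_def x2_def x3_def M1_def M2_def mut_vars_def)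
      qed
      ultimately show ?thesis using F3(2)[of "x(k := w x, m := y x)"] x pos[OF x] by simp
    qed
    have "\<exists>f\<in>laurent UNIV. \<exists>n. \<forall>x. (\<forall>i. x i > 0) \<longrightarrow> F1 (x(k := Z x)) * Z x ^ n = f x"
    proof (rule laurent_fraction[OF F1(1)])
      fix i
      show "(\<lambda>x. (x(k := Z x)) i) \<in> laurent UNIV" by (cases "i = k") (auto intro: ZL laurent.intros)
      have "(\<lambda>x. if i = k then 1 else inverse (x i) * Z x) \<in> laurent UNIV"
        by (cases "i = k") (auto intro!: laurent_intros ZL)
      then show "\<exists>h\<in>laurent UNIV. \<forall>x. (\<forall>i. x i > 0) \<longrightarrow> inverse ((x(k := Z x)) i) * Z x = h x"
        by (rule rev_bexI) (use nz in simp)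
    qed (rule ZL)
    then obtain f n where f: "f \<in> laurent UNIV" "\<And>x. \<forall>i. x i > 0 \<Longrightarrow> U x * Z x ^ n = f x"
      using U1 by auto
    have "\<exists>f\<in>laurent UNIV. \<exists>n. \<forall>x. (\<forall>i. x i > 0) \<longrightarrow>
      F3 (x(k := w x, m := y x)) * (y x * w x) ^ n = f x"
    proof (rule laurent_fraction[OF F3(1)])
      fix i
      show "(\<lambda>x. (x(k := w x, m := y x)) i) \<in> laurent UNIV"
        by (cases "i = k"; cases "i = m") (auto intro: yw laurent.intros)
      show "\<exists>h\<in>laurent UNIV. \<forall>x. (\<forall>i. x i > 0) \<longrightarrow>
        inverse ((x(k := w x, m := y x)) i) * (y x * w x) = h x"
      proof -
        have "(\<lambda>x. if i = m then w x else if i = k then y x else inverse (x i) * (y x * w x))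
            \<in> laurent UNIV"
          by (cases "i = m"; cases "i = k") (auto intro!: laurent_intros yw)
        then show ?thesis
          by (rule rev_bexI) (use nz in simp)
      qed
    qed (intro laurent_intros yw)
    then obtain g l where g: "g \<in> laurent UNIV"
      "\<And>x. \<forall>i. x i > 0 \<Longrightarrow> U x * (y x * w x) ^ l = g x"
      using U3 by auto
    have ZX: "Z x ^ n * x k ^ n = exchange_poly N' M' k x ^ n" if "\<forall>i. x i > 0" for x
    proof -
      have "x k \<noteq> 0" using that by (metis less_irrefl)
      then have "Z x * x k = exchange_poly N' M' k x" by (simp add: Z_def)
      then show ?thesis by (simp flip: power_mult_distrib)
    qed
    \<comment> \<open>The factor \<open>x k ^ n\<close> turns Z^n into a power of the exchange
      polynomial. That power divides f (x k)^n (y w)^l, and (y w)^l can be cancelled.\<close>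
    have "\<exists>h\<in>laurent UNIV. \<forall>x. (\<forall>i. x i > 0) \<longrightarrow> f x * x k ^ n = exchange_poly N' M' k x ^ n * h x"
    proof (rule coprime_to_exchange_cancel_power)
      show "coprime_to_exchange N' M' k (\<lambda>x. (y x * w x) ^ l)"
        by (intro coprime_to_exchange_power coprime_to_exchange_mult cop)
      show "(\<lambda>x. f x * x k ^ n) \<in> laurent UNIV" by (intro laurent_intros f)
      fix x :: "nat \<Rightarrow> real" assume x: "\<forall>i. x i > 0"
      show "f x * x k ^ n * (y x * w x) ^ l = exchange_poly N' M' k x ^ n * g x"
        unfolding f(2)[OF x, symmetric] g(2)[OF x, symmetric] ZX[OF x, symmetric] by (simp only: mult_ac)
    qed (rule g)
    then obtain h where h: "h \<in> laurent UNIV"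
      "\<And>x. \<forall>i. x i > 0 \<Longrightarrow> f x * x k ^ n = exchange_poly N' M' k x ^ n * h x" by blast
    have Uh: "U x = h x" if x: "\<forall>i. x i > 0" for x
    proof -
      have "exchange_poly N' M' k x ^ n * U x = exchange_poly N' M' k x ^ n * h x"
        using h(2)[OF x] unfolding f(2)[OF x, symmetric] ZX[OF x, symmetric] by (simp only: mult_ac)
      then show ?thesis using exchange_poly_pos[OF x, of N' M' k] by simp
    qed
    have "mut_vars_seq N M ks x j = h (x(N := 1))" if "\<forall>i. x i > 0" for x
    proof -
      have "mut_vars_seq N M ks x j = mut_vars_seq N M ks (x(N := 1)) j"
      proof -
        have "set ks \<subseteq> {..<N}" using less.prems by auto
        then show ?thesis using less.prems(4) by (subst mut_vars_seq_update_unused) auto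
      qed
      also have "\<dots> = U (x(N := 1))" unfolding U_def N'_def
        using less.prems by (subst mut_vars_seq_new_row[of N M' M ks r]) (auto simp: M'_def)
      finally show ?thesis using Uh[of "x(N := 1)"] that by simp
    qed
    moreover have "(\<lambda>x. h (x(N := 1))) \<in> laurent UNIV"
      by (rule laurent_update[OF h(1)]) (simp_all add: laurent.const)
    ultimately show ?thesis by - (rule bexI[of _ "\<lambda>x. h (x(N := 1))"], blast)
  qed
qed

section \<open>Orders of vanishing along monomial curves\<close>

definition mut_trop :: "nat \<Rightarrow> (nat \<Rightarrow> nat \<Rightarrow> int) \<Rightarrow> nat \<Rightarrow> (nat \<Rightarrow> int) \<Rightarrow> nat \<Rightarrow> int" where
  "mut_trop N M k v = v(k := min (\<Sum>i<N. int (nat (M i k)) * v i)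
     (\<Sum>i<N. int (nat (- M i k)) * v i) - v k)"

fun mut_trop_seq ::
    "nat \<Rightarrow> (nat \<Rightarrow> nat \<Rightarrow> int) \<Rightarrow> nat list \<Rightarrow> (nat \<Rightarrow> int) \<Rightarrow> nat \<Rightarrow> int" where
  "mut_trop_seq N M [] v = v"
| "mut_trop_seq N M (k # w) v = mut_trop_seq N (mut_mat k M) w (mut_trop N M k v)"

text \<open>Two-sided bounds force positivity on (0, 1], so sums cannot cancel and no leading
  coefficient has to be tracked.\<close>

definition has_order :: "(real \<Rightarrow> real) \<Rightarrow> int \<Rightarrow> bool" where
  "has_order f v \<longleftrightarrow> (\<exists>C>0. \<forall>s. 0 < s \<longrightarrow> s \<le> 1 \<longrightarrow> s powi v \<le> C * f s \<and> f s \<le> C * s powi v)"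

lemma has_order_const: "c > 0 \<Longrightarrow> has_order (\<lambda>s. c) 0"
  unfolding has_order_def
  by (rule exI[of _ "max c (inverse c)"]) (auto simp: less_max_iff_disj max_def field_simps)

lemma has_order_powi: "has_order (\<lambda>s. s powi v) v"
  unfolding has_order_def by (rule exI[of _ 1]) auto

lemma has_order_pos:
  assumes "has_order f v" "0 < s" "s \<le> 1"
  shows "f s > 0"
proof -
  obtain C where "C > 0" "s powi v \<le> C * f s" using assms unfolding has_order_def by blast
  moreover have "s powi v > 0" using assms by simp
  ultimately have "0 < C * f s" by linarith
  then show ?thesis using \<open>C > 0\<close> by (simp add: zero_less_mult_iff)
qed

lemma has_order_mult:
  assumes "has_order f v" "has_order g w"
  shows "has_order (\<lambda>s. f s * g s) (v + w)"
proof -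
  obtain C D where C: "C > 0" "D > 0"
    "\<And>s. 0 < s \<Longrightarrow> s \<le> 1 \<Longrightarrow> s powi v \<le> C * f s \<and> f s \<le> C * s powi v"
    "\<And>s. 0 < s \<Longrightarrow> s \<le> 1 \<Longrightarrow> s powi w \<le> D * g s \<and> g s \<le> D * s powi w"
    using assms unfolding has_order_def by blast
  have "s powi (v + w) \<le> (C * D) * (f s * g s) \<and> f s * g s \<le> (C * D) * s powi (v + w)"
    if s: "0 < s" "s \<le> 1" for s
  proof -
    have "s powi v * s powi w \<le> (C * f s) * (D * g s)"
      using C s has_order_pos[OF assms(1) s] by (intro mult_mono) (auto simp: mult_nonneg_nonneg)
    moreover have "f s * g s \<le> (C * s powi v) * (D * s powi w)"
      using C s has_order_pos[OF assms(1) s] has_order_pos[OF assms(2) s]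
      by (intro mult_mono) (auto simp: mult_nonneg_nonneg)
    ultimately show ?thesis using s by (simp add: power_int_add mult_ac)
  qed
  then show ?thesis unfolding has_order_def using C(1,2) by (intro exI[of _ "C * D"]) auto
qed

lemma has_order_inverse:
  assumes "has_order f v"
  shows "has_order (\<lambda>s. inverse (f s)) (- v)"
proof -
  obtain C where C: "C > 0" "\<And>s. 0 < s \<Longrightarrow> s \<le> 1 \<Longrightarrow> s powi v \<le> C * f s \<and> f s \<le> C * s powi v"
    using assms unfolding has_order_def by blast
  have "s powi - v \<le> C * inverse (f s) \<and> inverse (f s) \<le> C * s powi - v"
    if s: "0 < s" "s \<le> 1" for s
    using C(2)[OF s] C(1) has_order_pos[OF assms s] s
    by (auto simp: power_int_minus field_simps)
  then show ?thesis unfolding has_order_def using C(1) by blast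
qed

lemma has_order_add:
  assumes "has_order f v" "has_order g w"
  shows "has_order (\<lambda>s. f s + g s) (min v w)"
proof -
  obtain C D where C: "C > 0" "D > 0"
    "\<And>s. 0 < s \<Longrightarrow> s \<le> 1 \<Longrightarrow> s powi v \<le> C * f s \<and> f s \<le> C * s powi v"
    "\<And>s. 0 < s \<Longrightarrow> s \<le> 1 \<Longrightarrow> s powi w \<le> D * g s \<and> g s \<le> D * s powi w"
    using assms unfolding has_order_def by blast
  have "s powi min v w \<le> (C + D) * (f s + g s) \<and> f s + g s \<le> (C + D) * s powi min v w"
    if s: "0 < s" "s \<le> 1" for s
  proof -
    have pos: "f s > 0" "g s > 0" using assms s has_order_pos by blast+
    have "C * f s \<le> (C + D) * (f s + g s)" "D * g s \<le> (C + D) * (f s + g s)"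
      using pos C(1,2) by (intro mult_mono; simp)+
    then have 1: "s powi min v w \<le> (C + D) * (f s + g s)"
      using C(3)[OF s] C(4)[OF s] by (auto simp: min_def)
    have "s powi v \<le> s powi min v w" "s powi w \<le> s powi min v w"
      using s by (auto intro!: power_int_decreasing)
    then have "f s \<le> C * s powi min v w" "g s \<le> D * s powi min v w"
      using C(3)[OF s] C(4)[OF s] C(1,2) by (meson mult_left_mono order_trans less_imp_le)+
    with 1 show ?thesis by (simp add: distrib_right)
  qed
  then show ?thesis unfolding has_order_def using C(1,2) by (intro exI[of _ "C + D"]) auto
qed

lemma has_order_power: "has_order f v \<Longrightarrow> has_order (\<lambda>s. f s ^ n) (int n * v)"
  using has_order_const[of 1] has_order_mult[of f v "\<lambda>s. f s ^ n" "int n * v" for n]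
  by (induction n) (auto simp: algebra_simps)

lemma has_order_prod:
  assumes "finite A" "\<And>i. i \<in> A \<Longrightarrow> has_order (f i) (v i)"
  shows "has_order (\<lambda>s. \<Prod>i\<in>A. f i s) (\<Sum>i\<in>A. v i)"
  using assms by (induction A rule: finite_induct) (auto intro: has_order_const has_order_mult)

text \<open>Mutation consists of products, sums and inverses only, and on these the order acts by +,
  min and negation.\<close>

lemma has_order_mut_vars_seq:
  assumes "\<And>i. has_order (\<lambda>s. x s i) (v i)"
  shows "has_order (\<lambda>s. mut_vars_seq N M w (x s) j) (mut_trop_seq N M w v j)"
  using assms
proof (induction w arbitrary: M x v)
  case (Cons k w)
  have "has_order (\<lambda>s. exchange_poly N M k (x s) * inverse (x s k)) (mut_trop N M k v k)"
    unfolding exchange_poly_def mut_trop_def fun_upd_same diff_conv_add_uminus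
    by (intro has_order_mult has_order_add has_order_prod has_order_power has_order_inverse
        Cons.prems finite_lessThan)
  then have "has_order (\<lambda>s. mut_vars N M k (x s) i) (mut_trop N M k v i)" for i
    using Cons.prems by (cases "i = k") (simp_all add: mut_vars_def mut_trop_def divide_inverse)
  from Cons.IH[OF this] show ?case by simp
qed simp

lemma has_order_bounded:
  assumes "has_order f v" "\<And>s. 0 < s \<Longrightarrow> s \<le> 1 \<Longrightarrow> f s \<le> K"
  shows "v \<ge> 0"
proof (rule ccontr)
  assume "\<not> v \<ge> 0"
  then have v: "v \<le> -1" by simp
  obtain C where C: "C > 0" "\<And>s. 0 < s \<Longrightarrow> s \<le> 1 \<Longrightarrow> s powi v \<le> C * f s"
    using assms unfolding has_order_def by blast
  have K: "K > 0" using has_order_pos[OF assms(1), of 1] assms(2)[of 1] by simp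
  \<comment> \<open>Chosen so that \<open>s powi (-1)\<close> exceeds the upper bound
    \<open>C * K\<close>.\<close>
  define s where "s = inverse (C * K + 1)"
  have s: "0 < s" "s \<le> 1" using C(1) K by (auto simp: s_def inverse_le_1_iff add_pos_pos)
  have "C * K + 1 = s powi (-1)" by (simp add: s_def)
  also have "\<dots> \<le> s powi v" using s v by (intro power_int_decreasing) auto
  also have "\<dots> \<le> C * f s" using C(2) s by blast
  also have "\<dots> \<le> C * K" using C(1) assms(2)[OF s] by simp
  finally show False by simp
qed

section \<open>Polynomiality in the frozen variables\<close>

lemma laurent_clear_denominator:
  assumes "F \<in> laurent I"
  shows "\<exists>F0\<in>laurent (I - {a}). \<exists>n. \<forall>x. x a \<noteq> 0 \<longrightarrow> F x * x a ^ n = F0 x"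
  using assms
proof (induction rule: laurent.induct)
  case (const c)
  show ?case by (intro bexI[of _ "\<lambda>x. c"] exI[of _ 0]) (auto intro: laurent.intros)
next
  case (var i)
  show ?case by (intro bexI[of _ "\<lambda>x. x i"] exI[of _ 0]) (auto intro: laurent.intros)
next
  case (inv i)
  show ?case
  proof (cases "i = a")
    case True
    then show ?thesis by (intro bexI[of _ "\<lambda>x. 1"] exI[of _ 1]) (auto intro: laurent.intros)
  next
    case False
    then show ?thesis using inv
      by (intro bexI[of _ "\<lambda>x. inverse (x i)"] exI[of _ 0]) (auto intro: laurent.intros)
  qed
next
  case (add F G)
  then obtain F0 n G0 m where *: "F0 \<in> laurent (I - {a})" "G0 \<in> laurent (I - {a})"
    "\<And>x. x a \<noteq> 0 \<Longrightarrow> F0 x = F x * x a ^ n" "\<And>x. x a \<noteq> 0 \<Longrightarrow> G0 x = G x * x a ^ m"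
    by metis
  have "(\<lambda>x. F0 x * x a ^ m + G0 x * x a ^ n) \<in> laurent (I - {a})" by (intro laurent_intros *)
  then show ?case
    by (rule rev_bexI, intro exI[of _ "n + m"]) (simp add: * algebra_simps power_add)
next
  case (mult F G)
  then obtain F0 n G0 m where *: "F0 \<in> laurent (I - {a})" "G0 \<in> laurent (I - {a})"
    "\<And>x. x a \<noteq> 0 \<Longrightarrow> F0 x = F x * x a ^ n" "\<And>x. x a \<noteq> 0 \<Longrightarrow> G0 x = G x * x a ^ m"
    by metis
  have "(\<lambda>x. F0 x * G0 x) \<in> laurent (I - {a})" by (intro laurent_intros *)
  then show ?case
    by (rule rev_bexI, intro exI[of _ "n + m"]) (simp add: * algebra_simps power_add)
qed

lemma laurent_isCont:
  assumes "F \<in> laurent I" "a \<notin> I"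
  shows "isCont (\<lambda>s. F (c(a := s))) t"
  using assms(1)
proof (induction rule: laurent.induct)
  case (var i)
  show ?case by (cases "i = a") simp_all
next
  case (inv i)
  then have "i \<noteq> a" using assms(2) by auto
  then show ?case by simp
qed (auto intro: continuous_intros)

text \<open>If F0 / (x a)^n with n > 0 stays bounded near x a = 0, then F0 vanishes there, and the
  factor theorem with \<tau> = 0 lowers n by one. Membership in \<open>laurent (I - {a})\<close>
  means that the dependence on \<open>x a\<close> is polynomial.\<close>

lemma laurent_remove_denominator:
  assumes F: "F \<in> laurent I"
    and bounded: "\<And>c. \<forall>i. c i > 0 \<Longrightarrow> \<exists>K. \<forall>s. 0 < s \<longrightarrow> s \<le> 1 \<longrightarrow> \<bar>F (c(a := s))\<bar> \<le> K"
  shows "\<exists>F'\<in>laurent (I - {a}). \<forall>x. (\<forall>i. x i > 0) \<longrightarrow> F x = F' x"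
proof -
  obtain F0 n where F0: "F0 \<in> laurent (I - {a})" "\<And>x. x a \<noteq> 0 \<Longrightarrow> F x * x a ^ n = F0 x"
    using laurent_clear_denominator[OF F] by blast
  have F0': "\<forall>x. (\<forall>i. x i > 0) \<longrightarrow> F x * x a ^ n = F0 x" using F0(2) by (metis less_irrefl)
  from F0(1) F0' show ?thesis
  proof (induction n arbitrary: F0)
    case 0
    then show ?case by (intro bexI[of _ F0]) auto
  next
    case (Suc n)
    have notin: "a \<notin> I - {a}" by simp
    have zero: "F0 (c(a := 0)) = 0" if c: "\<forall>i. c i > 0" for c
    proof -
      obtain K where K: "\<And>s. 0 < s \<Longrightarrow> s \<le> 1 \<Longrightarrow> \<bar>F (c(a := s))\<bar> \<le> K" using bounded[OF c] by blast
      have "((\<lambda>s. F0 (c(a := s))) \<longlongrightarrow> F0 (c(a := 0))) (at_right 0)"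
        using laurent_isCont[OF Suc.prems(1) notin, where c = c and t = 0]
        unfolding isCont_def filterlim_at_split by (rule conjunct2)
      moreover have "((\<lambda>s. F0 (c(a := s))) \<longlongrightarrow> 0) (at_right 0)"
      proof (rule tendsto_0_le[where f = "\<lambda>s. s ^ Suc n" and K = K])
        have "eventually (\<lambda>s::real. s \<in> {0<..<1}) (at_right 0)"
          by (rule eventually_at_right_real) simp
        then show "eventually (\<lambda>s. norm (F0 (c(a := s))) \<le> norm (s ^ Suc n) * K) (at_right 0)"
        proof eventually_elim
          case (elim s)
          then have "\<forall>i. (c(a := s)) i > 0" using c by simp
          from mp[OF spec[OF Suc.prems(2)] this]
          have "F0 (c(a := s)) = F (c(a := s)) * s ^ Suc n" by (simp only: fun_upd_same)
          then show ?case using K[of s] elim by (simp add: abs_mult mult_right_mono mult.commute)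
        qed
        have "((\<lambda>s::real. s ^ Suc n) \<longlongrightarrow> 0 ^ Suc n) (at_right 0)" by (intro tendsto_intros)
        then show "((\<lambda>s::real. s ^ Suc n) \<longlongrightarrow> 0) (at_right 0)" by simp
      qed
      ultimately show ?thesis by (rule tendsto_unique[rotated]) simp
    qed
    have "\<exists>H\<in>laurent (I - {a}). \<forall>x. (\<forall>i\<in>I - {a}. x i \<noteq> 0) \<longrightarrow> (a \<in> I - {a} \<longrightarrow> 0 \<noteq> (0::real)) \<longrightarrow>
        F0 x - F0 (x(a := 0)) = (x a - 0) * H x"
      by (rule laurent_update_factor[OF Suc.prems(1)]) (auto intro: laurent.intros)
    then obtain H where H: "H \<in> laurent (I - {a})"
      "\<And>x. \<forall>i. x i \<noteq> 0 \<Longrightarrow> F0 x - F0 (x(a := 0)) = x a * H x" by auto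
    have "F x * x a ^ n = H x" if x: "\<forall>i. x i > 0" for x
    proof -
      have nz: "\<forall>i. x i \<noteq> 0" using x by (metis less_irrefl)
      have "x a * (F x * x a ^ n) = x a * H x"
        using H(2)[OF nz] zero[OF x] mp[OF spec[OF Suc.prems(2)] x] by (simp add: mult_ac)
      then show ?thesis using nz by simp
    qed
    then show ?case using Suc.IH[OF H(1)] by blast
  qed
qed

lemma mut_trop_seq_unit:
  assumes "set w \<subseteq> {..<r}" "r \<le> a"
  shows "mut_trop_seq N M w (\<lambda>i. if i = a then 1 else 0) = (\<lambda>i. if i = a then 1 else 0)"
  using assms(1)
proof (induction w arbitrary: M)
  case (Cons k w)
  have sum: "(\<Sum>i<N. int (e i) * (if i = a then 1 else 0)) = (if a < N then int (e a) else 0)" for e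
    by (simp add: if_distrib[of "\<lambda>z. _ * z"] sum.delta cong: if_cong)
  have "k \<noteq> a" using Cons.prems assms(2) by auto
  then have "mut_trop N M k (\<lambda>i. if i = a then 1 else 0) = (\<lambda>i. if i = a then 1 else 0)"
    unfolding mut_trop_def sum by (auto simp: min_def)
  with Cons show ?case by simp
qed simp

text \<open>The denominators are monomials, so they can be removed one frozen variable at a time. On
  the curve x a = s the variable has order 0, or 1 for \<open>j = a\<close>, and so it is
  bounded.\<close>

theorem laurent_phenomenon_polynomial:
  assumes "skew r M" "r \<le> N" "set w \<subseteq> {..<r}" "j < N" "finite A" "A \<subseteq> {r..}"
  shows "\<exists>F\<in>laurent (- A). \<forall>x. (\<forall>i. x i > 0) \<longrightarrow> mut_vars_seq N M w x j = F x"
  using assms(5,6)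
proof (induction A rule: finite_induct)
  case empty
  then show ?case using laurent_phenomenon[OF assms(1-4)] by simp
next
  case (insert a A)
  then obtain F where F: "F \<in> laurent (- A)" "\<And>x. \<forall>i. x i > 0 \<Longrightarrow> mut_vars_seq N M w x j = F x"
    by blast
  have "\<exists>K. \<forall>s. 0 < s \<longrightarrow> s \<le> 1 \<longrightarrow> \<bar>F (c(a := s))\<bar> \<le> K" if c: "\<forall>i. c i > 0" for c
  proof -
    have "has_order (\<lambda>s. (c(a := s)) i) (if i = a then 1 else 0)" for i
      using has_order_powi[of 1] has_order_const[of "c i"] c by (cases "i = a") auto
    from has_order_mut_vars_seq[where x = "\<lambda>s. c(a := s)" and v = "\<lambda>i. if i = a then 1 else 0"
        and N = N and M = M and w = w and j = j, OF this]
    have "has_order (\<lambda>s. mut_vars_seq N M w (c(a := s)) j) (if j = a then 1 else 0)"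
      using mut_trop_seq_unit[OF assms(3), of a N M] insert.prems by simp
    then obtain C where C: "C > 0" "\<And>s. 0 < s \<Longrightarrow> s \<le> 1 \<Longrightarrow>
        mut_vars_seq N M w (c(a := s)) j \<le> C * s powi (if j = a then 1 else 0)"
      unfolding has_order_def by blast
    have "\<bar>F (c(a := s))\<bar> \<le> C" if s: "0 < s" "s \<le> 1" for s
    proof -
      have p: "\<forall>i. (c(a := s)) i > 0" using c s by simp
      have "s powi (if j = a then 1 else 0) \<le> 1" using s by simp
      then have "C * s powi (if j = a then 1 else 0) \<le> C" using C(1) by (simp add: mult_left_le)
      then show ?thesis using C(2)[OF s] F(2)[OF p] mut_vars_seq_pos[OF p, of N M w j] by linarith
    qed
    then show ?thesis by blast
  qed
  from laurent_remove_denominator[OF F(1) this]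
  obtain F' where "F' \<in> laurent (- A - {a})" "\<And>x. \<forall>i. x i > 0 \<Longrightarrow> F x = F' x" by blast
  moreover have "- A - {a} = - insert a A" by auto
  ultimately show ?case using F(2) by (intro bexI[of _ F']) auto
qed

section \<open>Nonnegativity of the tropical exponents\<close>

lemma laurent_bounded:
  assumes "F \<in> laurent I" "\<And>i s. 0 < s \<Longrightarrow> s \<le> 1 \<Longrightarrow> \<bar>x s i\<bar> \<le> (1::real)"
    and "\<And>i s. i \<in> I \<Longrightarrow> 0 < s \<Longrightarrow> s \<le> 1 \<Longrightarrow> x s i = 1"
  shows "\<exists>K. \<forall>s::real. 0 < s \<longrightarrow> s \<le> 1 \<longrightarrow> \<bar>F (x s)\<bar> \<le> K"
  using assms(1)
proof (induction rule: laurent.induct)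
  case (const c)
  show ?case by blast
next
  case (var i)
  show ?case using assms(2) by blast
next
  case (inv i)
  show ?case using assms(3)[OF inv] by (intro exI[of _ 1]) simp
next
  case (add F G)
  then obtain K L where "\<And>s. 0 < s \<Longrightarrow> s \<le> 1 \<Longrightarrow> \<bar>F (x s)\<bar> \<le> K"
    "\<And>s. 0 < s \<Longrightarrow> s \<le> 1 \<Longrightarrow> \<bar>G (x s)\<bar> \<le> L" by blast
  then have "\<bar>F (x s) + G (x s)\<bar> \<le> K + L" if "0 < s" "s \<le> 1" for s
    using that abs_triangle_ineq[of "F (x s)" "G (x s)"] by (meson add_mono order_trans)
  then show ?case by blast
next
  case (mult F G)
  then obtain K L where "\<And>s. 0 < s \<Longrightarrow> s \<le> 1 \<Longrightarrow> \<bar>F (x s)\<bar> \<le> K"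
    "\<And>s. 0 < s \<Longrightarrow> s \<le> 1 \<Longrightarrow> \<bar>G (x s)\<bar> \<le> L" by blast
  then have "\<bar>F (x s) * G (x s)\<bar> \<le> K * L" if "0 < s" "s \<le> 1" for s
    using that unfolding abs_mult by (meson abs_ge_zero mult_mono order_trans)
  then show ?case by blast
qed

theorem mut_trop_seq_nonneg:
  assumes "skew r M" "r \<le> N" "set w \<subseteq> {..<r}" "j < N"
    and v: "\<And>i. i < r \<Longrightarrow> v i = 0" "\<And>i. r \<le> i \<Longrightarrow> i < N \<Longrightarrow> v i \<ge> 0" "\<And>i. N \<le> i \<Longrightarrow> v i = 0"
  shows "mut_trop_seq N M w v j \<ge> 0"
proof -
  obtain F where F: "F \<in> laurent (- {r..<N})"
    "\<And>x. \<forall>i. x i > 0 \<Longrightarrow> mut_vars_seq N M w x j = F x"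
    using laurent_phenomenon_polynomial[OF assms(1-4), of "{r..<N}"]
    by (metis finite_atLeastLessThan atLeastLessThan_iff atLeast_iff subsetI)
  \<comment> \<open>Now all frozen variables move at once. The indices in \<open>- {r..<N}\<close>,
    also those from \<open>N\<close> on, may be inverted; there \<open>v\<close> is 0, which keeps
    the coordinate at 1.\<close>
  define x where "x s = (\<lambda>i. s powi v i)" for s :: real
  have "v i \<ge> 0" for i using v(1)[of i] v(2)[of i] v(3)[of i] by linarith
  then have "\<exists>K. \<forall>s::real. 0 < s \<longrightarrow> s \<le> 1 \<longrightarrow> \<bar>F (x s)\<bar> \<le> K"
    by (intro laurent_bounded[OF F(1)]) (auto simp: x_def v not_le power_int_le_one)
  then obtain K where K: "\<And>s. 0 < s \<Longrightarrow> s \<le> 1 \<Longrightarrow> \<bar>F (x s)\<bar> \<le> K" by blast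
  show ?thesis
  proof (rule has_order_bounded)
    show "has_order (\<lambda>s. mut_vars_seq N M w (x s) j) (mut_trop_seq N M w v j)"
      by (rule has_order_mut_vars_seq) (simp add: x_def has_order_powi)
    show "mut_vars_seq N M w (x s) j \<le> K" if "0 < s" "s \<le> 1" for s
      using F(2)[of "x s"] K[OF that] that by (simp add: x_def)
  qed
qed

section \<open>Specialisation of algebraically independent elements\<close>

definition monomial_eval :: "'a::field_char_0 vec \<Rightarrow> (nat \<Rightarrow>\<^sub>0 nat) \<Rightarrow> 'a" where
  "monomial_eval x m = (\<Prod>i\<in>Poly_Mapping.keys m. (x $ i) ^ Poly_Mapping.lookup m i)"

lemma monomial_eval_superset:
  assumes "finite A" "Poly_Mapping.keys m \<subseteq> A"
  shows "monomial_eval x m = (\<Prod>i\<in>A. (x $ i) ^ Poly_Mapping.lookup m i)"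
  unfolding monomial_eval_def using assms
  by (intro prod.mono_neutral_left) (auto simp: in_keys_iff)

lemma monomial_eval_add: "monomial_eval x (m + m') = monomial_eval x m * monomial_eval x m'"
proof -
  let ?A = "Poly_Mapping.keys m \<union> Poly_Mapping.keys m'"
  have "Poly_Mapping.keys (m + m') \<subseteq> ?A" by (rule Poly_Mapping.keys_add)
  then show ?thesis
    by (simp add: monomial_eval_superset[of ?A] lookup_add power_add prod.distrib)
qed

lemma poly_eval_superset:
  assumes "finite A" "Poly_Mapping.keys f \<subseteq> A"
  shows "poly_eval x f = (\<Sum>m\<in>A. of_rat (Poly_Mapping.lookup f m) * monomial_eval x m)"
  unfolding poly_eval_def monomial_eval_def using assms
  by (intro sum.mono_neutral_left) (auto simp: in_keys_iff)

lemma poly_eval_add: "poly_eval x (f + g) = poly_eval x f + poly_eval x g"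
proof -
  let ?A = "Poly_Mapping.keys f \<union> Poly_Mapping.keys g"
  have "Poly_Mapping.keys (f + g) \<subseteq> ?A" by (rule Poly_Mapping.keys_add)
  then show ?thesis
    by (simp add: poly_eval_superset[of ?A] lookup_add of_rat_add distrib_right sum.distrib)
qed

lemma poly_eval_zero: "poly_eval x 0 = 0"
  by (simp add: poly_eval_def)

lemma poly_eval_sum: "poly_eval x (\<Sum>i\<in>A. f i) = (\<Sum>i\<in>A. poly_eval x (f i))"
  by (induction A rule: infinite_finite_induct) (simp_all add: poly_eval_zero poly_eval_add)

lemma poly_eval_single: "poly_eval x (Poly_Mapping.single m c) = of_rat c * monomial_eval x m"
  by (subst poly_eval_superset[of "{m}"]) auto

lemma poly_eval_one: "poly_eval x 1 = 1"
  using poly_eval_single[of x 0 1] by (simp add: monomial_eval_def)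

lemma poly_mapping_eq_sum_single:
  "f = (\<Sum>m\<in>Poly_Mapping.keys f. Poly_Mapping.single m (Poly_Mapping.lookup f m))"
  by (rule poly_mapping_eqI) (auto simp: lookup_sum lookup_single when_def in_keys_iff sum.delta)

lemma poly_eval_mult: "poly_eval x (f * g) = poly_eval x f * poly_eval x g"
proof -
  let ?s = "\<lambda>f m. Poly_Mapping.single m (Poly_Mapping.lookup f m)"
  have "f * g = (\<Sum>m\<in>Poly_Mapping.keys f. \<Sum>m'\<in>Poly_Mapping.keys g. ?s f m * ?s g m')"
    by (subst poly_mapping_eq_sum_single[of f], subst poly_mapping_eq_sum_single[of g])
      (rule sum_product)
  then have "poly_eval x (f * g) = (\<Sum>m\<in>Poly_Mapping.keys f. \<Sum>m'\<in>Poly_Mapping.keys g.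
      (of_rat (Poly_Mapping.lookup f m) * monomial_eval x m)
      * (of_rat (Poly_Mapping.lookup g m') * monomial_eval x m'))"
    by (simp only: poly_eval_sum mult_single poly_eval_single monomial_eval_add of_rat_mult mult_ac)
  also have "\<dots> = poly_eval x f * poly_eval x g"
    by (simp only: poly_eval_superset[OF finite_keys subset_refl] sum_product)
  finally show ?thesis .
qed

definition polys :: "nat \<Rightarrow> ((nat \<Rightarrow>\<^sub>0 nat) \<Rightarrow>\<^sub>0 rat) set" where
  "polys n = {f. \<forall>m\<in>Poly_Mapping.keys f. Poly_Mapping.keys m \<subseteq> {..<n}}"

lemma polys_add: "f \<in> polys n \<Longrightarrow> g \<in> polys n \<Longrightarrow> f + g \<in> polys n"
  unfolding polys_def using Poly_Mapping.keys_add[of f g] by blast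

lemma polys_mult:
  assumes "f \<in> polys n" "g \<in> polys n"
  shows "f * g \<in> polys n"
  unfolding polys_def
proof (intro CollectI ballI)
  fix m assume "m \<in> Poly_Mapping.keys (f * g)"
  then obtain a b where "m = a + b" "a \<in> Poly_Mapping.keys f" "b \<in> Poly_Mapping.keys g"
    using keys_mult[of f g] by blast
  then show "Poly_Mapping.keys m \<subseteq> {..<n}"
    using assms Poly_Mapping.keys_add[of a b] unfolding polys_def by blast
qed

lemma polys_single: "Poly_Mapping.keys m \<subseteq> {..<n} \<Longrightarrow> Poly_Mapping.single m c \<in> polys n"
  unfolding polys_def by auto

lemma polys_one: "1 \<in> polys n"
  using polys_single[of 0 n 1] by simp

text \<open>The element \<open>a\<close> is a rational function of \<open>x\<close> that is regular at \<open>p\<close> with value \<open>q\<close>.\<close>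

definition specialises :: "'a::field_char_0 vec \<Rightarrow> rat vec \<Rightarrow> 'a \<Rightarrow> rat \<Rightarrow> bool" where
  "specialises x p a q \<longleftrightarrow> (\<exists>f\<in>polys (dim_vec x). \<exists>g\<in>polys (dim_vec x). poly_eval p g \<noteq> 0 \<and>
     a * poly_eval x g = poly_eval x f \<and> q * poly_eval p g = poly_eval p f)"

lemma specialisesE:
  assumes "specialises x p a q"
  obtains f g where "f \<in> polys (dim_vec x)" "g \<in> polys (dim_vec x)" "poly_eval p g \<noteq> 0"
    "poly_eval x f = a * poly_eval x g" "poly_eval p f = q * poly_eval p g"
  using assms unfolding specialises_def by metis

lemma specialisesI:
  assumes "f \<in> polys (dim_vec x)" "g \<in> polys (dim_vec x)" "poly_eval p g \<noteq> 0"
    "a * poly_eval x g = poly_eval x f" "q * poly_eval p g = poly_eval p f"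
  shows "specialises x p a q"
  using assms unfolding specialises_def by blast

lemma specialises_rat: "specialises x p (of_rat c) c"
  by (rule specialisesI[of "Poly_Mapping.single 0 c" _ 1])
    (auto intro: polys_single polys_one simp: poly_eval_single poly_eval_one monomial_eval_def)

lemma specialises_var: "i < dim_vec x \<Longrightarrow> specialises x p (x $ i) (p $ i)"
  by (rule specialisesI[of "Poly_Mapping.single (Poly_Mapping.single i 1) 1" _ 1])
    (auto intro: polys_single polys_one simp: poly_eval_single poly_eval_one monomial_eval_def)

lemma specialises_add:
  assumes "specialises x p a q" "specialises x p a' q'"
  shows "specialises x p (a + a') (q + q')"
proof -
  obtain f g f' g' where *: "f \<in> polys (dim_vec x)" "g \<in> polys (dim_vec x)" "poly_eval p g \<noteq> 0"
    "poly_eval x f = a * poly_eval x g" "poly_eval p f = q * poly_eval p g"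
    "f' \<in> polys (dim_vec x)" "g' \<in> polys (dim_vec x)" "poly_eval p g' \<noteq> 0"
    "poly_eval x f' = a' * poly_eval x g'" "poly_eval p f' = q' * poly_eval p g'"
    using assms by (metis specialisesE)
  show ?thesis
    by (rule specialisesI[of "f * g' + f' * g" _ "g * g'"])
      (auto simp: * poly_eval_add poly_eval_mult algebra_simps intro: polys_add polys_mult *)
qed

lemma specialises_mult:
  assumes "specialises x p a q" "specialises x p a' q'"
  shows "specialises x p (a * a') (q * q')"
proof -
  obtain f g f' g' where *: "f \<in> polys (dim_vec x)" "g \<in> polys (dim_vec x)" "poly_eval p g \<noteq> 0"
    "poly_eval x f = a * poly_eval x g" "poly_eval p f = q * poly_eval p g"
    "f' \<in> polys (dim_vec x)" "g' \<in> polys (dim_vec x)" "poly_eval p g' \<noteq> 0"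
    "poly_eval x f' = a' * poly_eval x g'" "poly_eval p f' = q' * poly_eval p g'"
    using assms by (metis specialisesE)
  show ?thesis
    by (rule specialisesI[of "f * f'" _ "g * g'"])
      (auto simp: * poly_eval_mult mult_ac intro: polys_mult *)
qed

lemma specialises_one: "specialises x p 1 1"
  using specialises_rat[of x p 1] by simp

lemma specialises_uminus: "specialises x p a q \<Longrightarrow> specialises x p (- a) (- q)"
  using specialises_mult[OF specialises_rat[of x p "-1"]] by (force simp: of_rat_minus)

lemma specialises_power: "specialises x p a q \<Longrightarrow> specialises x p (a ^ n) (q ^ n)"
  by (induction n) (auto intro: specialises_one specialises_mult)

lemma specialises_prod:
  "(\<And>i. i \<in> A \<Longrightarrow> specialises x p (a i) (q i)) \<Longrightarrow> specialises x p (\<Prod>i\<in>A. a i) (\<Prod>i\<in>A. q i)"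
  by (induction A rule: infinite_finite_induct) (auto intro: specialises_one specialises_mult)

text \<open>A polynomial that vanishes at algebraically independent elements is the zero polynomial,
  so it vanishes at \<open>p\<close> as well. This makes the value at \<open>p\<close> independent
  of the chosen fraction.\<close>

lemma specialises_zero:
  assumes "alg_independent x" "specialises x p 0 q"
  shows "q = 0"
proof -
  obtain f g where *: "f \<in> polys (dim_vec x)" "poly_eval p g \<noteq> 0"
    "poly_eval x f = 0" "poly_eval p f = q * poly_eval p g"
    using assms(2) by (metis specialisesE mult_zero_left)
  then have "f = 0" using assms(1) unfolding alg_independent_def polys_def by blast
  then show ?thesis using * by (simp add: poly_eval_zero)
qed

lemma specialises_unique:
  assumes "alg_independent x" "specialises x p a q" "specialises x p a q'"
  shows "q = q'"
  using specialises_zero[OF assms(1), of p "q + - q'"]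
    specialises_add[OF assms(2) specialises_uminus[OF assms(3)]] by simp

lemma specialises_inverse:
  assumes "alg_independent x" "specialises x p a q" "q \<noteq> 0"
  shows "specialises x p (inverse a) (inverse q)"
proof -
  have "a \<noteq> 0" using specialises_zero assms by blast
  moreover obtain f g where "f \<in> polys (dim_vec x)" "g \<in> polys (dim_vec x)" "poly_eval p g \<noteq> 0"
    "poly_eval x f = a * poly_eval x g" "poly_eval p f = q * poly_eval p g"
    using assms(2) by (rule specialisesE)
  ultimately show ?thesis using assms(3) by (intro specialisesI[of g _ f]) auto
qed

text \<open>Each entry specialises to 1 at the point with all coordinates 1, whereas 0 specialises
  only to 0.\<close>

lemma alg_independent_nonzero:
  assumes "alg_independent x" "i < dim_vec x"
  shows "x $ i \<noteq> 0"
proof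
  assume "x $ i = 0"
  moreover have "specialises x (vec (dim_vec x) (\<lambda>_. 1)) (x $ i) 1"
    using specialises_var[OF assms(2), of "vec (dim_vec x) (\<lambda>_. 1)"] assms(2) by simp
  ultimately show False using specialises_zero[OF assms(1)] by fastforce
qed

section \<open>Twisting by monomials in the frozen variables\<close>

lemma prod_power_twist:
  fixes y x :: "nat \<Rightarrow> 'a::field"
  assumes y: "\<And>n. n < r \<Longrightarrow> y n = x n * (\<Prod>i<l. x (r + i) powi v i n)"
      "\<And>n. r \<le> n \<Longrightarrow> n < N \<Longrightarrow> y n = (\<Prod>i<l. x (r + i) powi v i n)"
    and nz: "\<And>i. i < l \<Longrightarrow> x (r + i) \<noteq> 0" and "r \<le> N"
  shows "(\<Prod>n<N. y n ^ e n) = (\<Prod>n<r. x n ^ e n) * (\<Prod>i<l. x (r + i) powi (\<Sum>n<N. int (e n) * v i n))"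
proof -
  have "(\<Prod>n<N. y n ^ e n)
      = (\<Prod>n<N. (if n < r then x n ^ e n else 1) * (\<Prod>i<l. x (r + i) powi v i n) ^ e n)"
    using y by (intro prod.cong) (auto simp: power_mult_distrib not_less)
  also have "\<dots> = (\<Prod>n<N. if n < r then x n ^ e n else 1)
      * (\<Prod>n<N. \<Prod>i<l. x (r + i) powi (int (e n) * v i n))"
    by (simp add: prod.distrib prod_power_distrib power_int_mult mult.commute[of "int _"])
  also have "(\<Prod>n<N. if n < r then x n ^ e n else 1) = (\<Prod>n<r. x n ^ e n)"
    using \<open>r \<le> N\<close> by (intro prod.mono_neutral_cong_right) auto
  also have "(\<Prod>n<N. \<Prod>i<l. x (r + i) powi (int (e n) * v i n))
      = (\<Prod>i<l. \<Prod>n<N. x (r + i) powi (int (e n) * v i n))" by (rule prod.swap)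
  also have "\<dots> = (\<Prod>i<l. x (r + i) powi (\<Sum>n<N. int (e n) * v i n))"
  proof (intro prod.cong refl)
    fix i assume "i \<in> {..<l}"
    then have "x (r + i) \<noteq> 0" using nz by simp
    then show "(\<Prod>n<N. x (r + i) powi (int (e n) * v i n)) = x (r + i) powi (\<Sum>n<N. int (e n) * v i n)"
      by (induction N) (simp_all add: power_int_add)
  qed
  finally show ?thesis .
qed

lemma prod_lessThan_add_split:
  fixes g :: "nat \<Rightarrow> 'a::comm_monoid_mult"
  shows "(\<Prod>i<m + n. g i) = (\<Prod>i<m. g i) * (\<Prod>i<n. g (m + i))"
  by (induction n) (simp_all add: mult.assoc)

lemma trop_difference:
  "(\<Sum>n<N. int (nat (M n k)) * v n) - (\<Sum>n<N. int (nat (- M n k)) * v n) = (\<Sum>n<N. v n * M n k)"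
  unfolding sum_subtractf[symmetric] by (intro sum.cong) (auto simp: int_nat_eq)

lemma exchange_poly_twist:
  fixes y x :: "nat \<Rightarrow> 'a::field"
  assumes y: "\<And>n. n < r \<Longrightarrow> y n = x n * (\<Prod>i<l. x (r + i) powi v i n)"
      "\<And>n. r \<le> n \<Longrightarrow> n < N \<Longrightarrow> y n = (\<Prod>i<l. x (r + i) powi v i n)"
    and nz: "\<And>i. i < l \<Longrightarrow> x (r + i) \<noteq> 0" and "r \<le> N"
    and M: "\<And>n. n < r \<Longrightarrow> M n k = M' n k" "\<And>i. i < l \<Longrightarrow> (\<Sum>n<N. v i n * M n k) = M' (r + i) k"
  shows "exchange_poly N M k y = (\<Prod>i<l. x (r + i) powi
      min (\<Sum>n<N. int (nat (M n k)) * v i n) (\<Sum>n<N. int (nat (- M n k)) * v i n))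
    * exchange_poly (r + l) M' k x"
proof -
  define \<alpha> where "\<alpha> i = (\<Sum>n<N. int (nat (M n k)) * v i n)" for i
  define \<beta> where "\<beta> i = (\<Sum>n<N. int (nat (- M n k)) * v i n)" for i
  have diff: "\<alpha> i - \<beta> i = M' (r + i) k" if "i < l" for i
    using M(2)[OF that] trop_difference[of M k "v i" N] by (simp add: \<alpha>_def \<beta>_def)
  have *: "x (r + i) powi \<alpha> i = x (r + i) powi min (\<alpha> i) (\<beta> i) * x (r + i) ^ nat (M' (r + i) k)"
      "x (r + i) powi \<beta> i = x (r + i) powi min (\<alpha> i) (\<beta> i) * x (r + i) ^ nat (- M' (r + i) k)"
    if "i < l" for i
  proof -
    have e: "\<alpha> i = min (\<alpha> i) (\<beta> i) + int (nat (M' (r + i) k))"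
      "\<beta> i = min (\<alpha> i) (\<beta> i) + int (nat (- M' (r + i) k))"
      using diff[OF that] by (auto simp: min_def)
    show "x (r + i) powi \<alpha> i = x (r + i) powi min (\<alpha> i) (\<beta> i) * x (r + i) ^ nat (M' (r + i) k)"
      by (subst e(1)) (simp only: power_int_add power_int_of_nat nz[OF that] simp_thms)
    show "x (r + i) powi \<beta> i = x (r + i) powi min (\<alpha> i) (\<beta> i) * x (r + i) ^ nat (- M' (r + i) k)"
      by (subst e(2)) (simp only: power_int_add power_int_of_nat nz[OF that] simp_thms)
  qed
  have tw: "(\<Prod>n<N. y n ^ e n)
      = (\<Prod>n<r. x n ^ e n) * (\<Prod>i<l. x (r + i) powi (\<Sum>n<N. int (e n) * v i n))" for e
    by (rule prod_power_twist[OF assms(1-4)])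
  have "exchange_poly N M k y
      = (\<Prod>n<r. x n ^ nat (M n k)) * (\<Prod>i<l. x (r + i) powi \<alpha> i)
      + (\<Prod>n<r. x n ^ nat (- M n k)) * (\<Prod>i<l. x (r + i) powi \<beta> i)"
    unfolding exchange_poly_def \<alpha>_def \<beta>_def by (simp only: tw)
  also have "(\<Prod>i<l. x (r + i) powi \<alpha> i) = (\<Prod>i<l. x (r + i) powi min (\<alpha> i) (\<beta> i))
      * (\<Prod>i<l. x (r + i) ^ nat (M' (r + i) k))" by (simp add: * flip: prod.distrib)
  also have "(\<Prod>i<l. x (r + i) powi \<beta> i) = (\<Prod>i<l. x (r + i) powi min (\<alpha> i) (\<beta> i))
      * (\<Prod>i<l. x (r + i) ^ nat (- M' (r + i) k))" by (simp add: * flip: prod.distrib)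
  also have "(\<Prod>n<r. x n ^ nat (M n k)) = (\<Prod>n<r. x n ^ nat (M' n k))" by (simp add: M(1))
  also have "(\<Prod>n<r. x n ^ nat (- M n k)) = (\<Prod>n<r. x n ^ nat (- M' n k))" by (simp add: M(1))
  finally show ?thesis
    unfolding exchange_poly_def prod_lessThan_add_split \<alpha>_def[symmetric] \<beta>_def[symmetric]
    by (simp only: distrib_left mult_ac)
qed

text \<open>This keeps the matrix condition R B + E P = P' alive under mutation. With \<alpha> -
  \<beta> = c k, the differences \<alpha> - min \<alpha> \<beta> and \<beta> - min \<alpha> \<beta>
  are the positive and negative parts of \<open>c k\<close>, which yields the mutation rule for a
  row of P'; the terms with \<open>v k\<close> cancel.\<close>

lemma mut_trop_relation:
  assumes M: "M k k = 0" "k < N" and c: "(\<Sum>n<N. v n * M n k) = c k" "(\<Sum>n<N. v n * M n j) = c j"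
  shows "(\<Sum>n<N. mut_trop N M k v n * mut_mat k M n j) = (if j = k then - c k
    else c j + max (c k) 0 * max (M k j) 0 - max (- c k) 0 * max (- M k j) 0)"
proof -
  define \<alpha> where "\<alpha> = (\<Sum>n<N. int (nat (M n k)) * v n)"
  define \<beta> where "\<beta> = (\<Sum>n<N. int (nat (- M n k)) * v n)"
  have ab: "\<alpha> - \<beta> = c k" using c trop_difference[of M k v N] by (simp add: \<alpha>_def \<beta>_def)
  let ?A = "{..<N} - {k}"
  have split: "(\<Sum>n<N. f n) = f k + (\<Sum>n\<in>?A. f n)" for f :: "nat \<Rightarrow> int"
    using M by (simp add: sum.remove)
  show ?thesis
  proof (cases "j = k")
    case True
    have "(\<Sum>n\<in>?A. mut_trop N M k v n * mut_mat k M n j) = - (\<Sum>n\<in>?A. v n * M n k)"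
      unfolding sum_negf[symmetric] using True
      by (intro sum.cong) (auto simp: mut_trop_def mut_mat_def)
    then show ?thesis using True M c(1) by (simp add: split mut_mat_def)
  next
    case False
    have "(\<Sum>n\<in>?A. mut_trop N M k v n * mut_mat k M n j) = (\<Sum>n\<in>?A. v n * M n j
        + max (M k j) 0 * (int (nat (M n k)) * v n) - max (- M k j) 0 * (int (nat (- M n k)) * v n))"
      using False by (intro sum.cong)
        (auto simp: mut_trop_def mut_mat_def int_nat_eq max_def algebra_simps)
    also have "\<dots> = (\<Sum>n\<in>?A. v n * M n j) + max (M k j) 0 * (\<Sum>n\<in>?A. int (nat (M n k)) * v n)
        - max (- M k j) 0 * (\<Sum>n\<in>?A. int (nat (- M n k)) * v n)"
      by (simp only: sum.distrib sum_subtractf sum_distrib_left)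
    also have "(\<Sum>n\<in>?A. v n * M n j) = c j - v k * M k j" using c(2) by (simp add: split)
    also have "(\<Sum>n\<in>?A. int (nat (M n k)) * v n) = \<alpha>" using M by (simp add: split \<alpha>_def)
    also have "(\<Sum>n\<in>?A. int (nat (- M n k)) * v n) = \<beta>" using M by (simp add: split \<beta>_def)
    finally have "(\<Sum>n<N. mut_trop N M k v n * mut_mat k M n j)
        = (min \<alpha> \<beta> - v k) * (- M k j) + (c j - v k * M k j + max (M k j) 0 * \<alpha> - max (- M k j) 0 * \<beta>)"
      using False by (simp add: split mut_trop_def mut_mat_def \<alpha>_def \<beta>_def)
    also have "\<dots> = c j + max (c k) 0 * max (M k j) 0 - max (- c k) 0 * max (- M k j) 0"
      unfolding ab[symmetric] by (simp add: min_def max_def algebra_simps)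
    finally show ?thesis using False by simp
  qed
qed

text \<open>Needed because \<open>seed_mat\<close> of a mutated seed is known only inside the
  matrix, entries out of range being unspecified; the recursion reads only entries inside.\<close>

lemma mut_trop_seq_cong:
  assumes "\<And>i j. i < N \<Longrightarrow> j < r \<Longrightarrow> M i j = M' i j" "set w \<subseteq> {..<r}" "r \<le> N"
  shows "mut_trop_seq N M w v = mut_trop_seq N M' w v"
  using assms
proof (induction w arbitrary: M M' v)
  case (Cons k w)
  then have k: "k < r" by simp
  have "mut_trop N M k v = mut_trop N M' k v"
    using Cons.prems(1) k by (simp add: mut_trop_def)
  moreover have "mut_mat k M i j = mut_mat k M' i j" if "i < N" "j < r" for i j
    using Cons.prems that k by (simp add: mut_mat_def)
  ultimately show ?case using Cons.IH[of "mut_mat k M" "mut_mat k M'"] Cons.prems by simp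
qed simp

section \<open>Seeds as functions\<close>

definition seed_vars :: "nat \<Rightarrow> 'a seed \<Rightarrow> nat \<Rightarrow> 'a" where
  "seed_vars r \<Sigma> n = (if n < r then cluster \<Sigma> $ n else frozen \<Sigma> $ (n - r))"

definition seed_mat :: "'a seed \<Rightarrow> nat \<Rightarrow> nat \<Rightarrow> int" where
  "seed_mat \<Sigma> i j = exmat \<Sigma> $$ (i, j)"

lemma is_seed_dims:
  assumes "is_seed r l \<Sigma>"
  shows "dim_vec (cluster \<Sigma>) = r" "dim_vec (frozen \<Sigma>) = l"
    "dim_row (exmat \<Sigma>) = r + l" "dim_col (exmat \<Sigma>) = r"
  using assms by (auto simp: is_seed_def)

lemma is_seed_skew:
  assumes "is_seed r l \<Sigma>"
  shows "skew r (seed_mat \<Sigma>)"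
proof -
  have "skew_symmetrizable (exchange_part \<Sigma>)" using assms by (simp add: is_seed_def)
  then obtain d :: "nat \<Rightarrow> int" where d: "\<forall>i<r. d i > 0"
    "\<forall>i<r. \<forall>j<r. d i * exchange_part \<Sigma> $$ (i, j) = - (d j * exchange_part \<Sigma> $$ (j, i))"
    unfolding skew_symmetrizable_def using is_seed_dims[OF assms] by (auto simp: exchange_part_def)
  have "exchange_part \<Sigma> $$ (i, j) = seed_mat \<Sigma> i j" if "i < r" "j < r" for i j
    using that is_seed_dims[OF assms] by (simp add: exchange_part_def seed_mat_def)
  then have "d i * seed_mat \<Sigma> i j = - (d j * seed_mat \<Sigma> j i)" if "i < r" "j < r" for i j
    using d(2) that by metis
  with d(1) show ?thesis unfolding skew_def by blast
qed

lemma seed_vars_nonzero: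
  assumes "is_seed r l \<Sigma>" "n < r + l"
  shows "seed_vars r \<Sigma> n \<noteq> 0"
proof -
  have "alg_independent (cluster \<Sigma> @\<^sub>v frozen \<Sigma>)"
    using assms by (simp add: is_seed_def freely_generates_def)
  from alg_independent_nonzero[OF this, of n] show ?thesis
    using assms is_seed_dims[OF assms(1)] by (auto simp: seed_vars_def)
qed

lemma vec_power_pos_part:
  "vec_power a (map_vec pos_part (vec (dim_vec a) f)) = (\<Prod>i<dim_vec a. (a $ i) ^ nat (f i))"
  unfolding vec_power_def by (intro prod.cong) (auto simp: pos_part_def max_def power_int_def)

lemma exchange_binomial_eq:
  assumes "is_seed r l \<Sigma>" "k < r"
  shows "exchange_binomial k \<Sigma> = exchange_poly (r + l) (seed_mat \<Sigma>) k (seed_vars r \<Sigma>)"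
proof -
  note dims = is_seed_dims[OF assms(1)]
  have b: "col (exchange_part \<Sigma>) k = vec (dim_vec (cluster \<Sigma>)) (\<lambda>i. seed_mat \<Sigma> i k)"
    "- vec (dim_vec (cluster \<Sigma>)) (\<lambda>i. seed_mat \<Sigma> i k) = vec (dim_vec (cluster \<Sigma>)) (\<lambda>i. - seed_mat \<Sigma> i k)"
    using assms(2) dims by (auto intro!: eq_vecI simp: exchange_part_def seed_mat_def)
  have c: "col (coefficient_part \<Sigma>) k = vec (dim_vec (frozen \<Sigma>)) (\<lambda>i. seed_mat \<Sigma> (r + i) k)"
    "- vec (dim_vec (frozen \<Sigma>)) (\<lambda>i. seed_mat \<Sigma> (r + i) k) = vec (dim_vec (frozen \<Sigma>)) (\<lambda>i. - seed_mat \<Sigma> (r + i) k)"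
    using assms(2) dims by (auto intro!: eq_vecI simp: coefficient_part_def seed_mat_def)
  show ?thesis
    unfolding exchange_binomial_def Let_def b c vec_power_pos_part exchange_poly_def
      prod_lessThan_add_split
    by (simp add: dims seed_vars_def)
qed

lemma seed_vars_mutate:
  assumes "is_seed r l \<Sigma>" "k < r"
  shows "seed_vars r (mutate k \<Sigma>) n = mut_vars (r + l) (seed_mat \<Sigma>) k (seed_vars r \<Sigma>) n"
  using assms is_seed_dims[OF assms(1)] exchange_binomial_eq[OF assms]
  by (auto simp: seed_vars_def mutate_def mut_vars_def)

lemma seed_mat_mutate:
  assumes "is_seed r l \<Sigma>" "k < r" "i < r + l" "j < r"
  shows "seed_mat (mutate k \<Sigma>) i j = mut_mat k (seed_mat \<Sigma>) i j"
  using assms is_seed_dims[OF assms(1)]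
  by (simp add: seed_mat_def mutate_def mutate_mat_def mut_mat_def pos_part_def)

section \<open>Walks in the regular tree\<close>

text \<open>Left multiplication by the generator \<open>k\<close> on reduced words, so that a second
  step with the same label returns.\<close>

definition tree_step :: "nat \<Rightarrow> nat list \<Rightarrow> nat list" where
  "tree_step k t = (if t \<noteq> [] \<and> hd t = k then tl t else k # t)"

lemma tree_edge_step:
  assumes "t \<in> tree_vertices r" "k < r"
  shows "tree_edge r k t (tree_step k t)"
  using assms by (cases t) (auto simp: tree_edge_def tree_step_def tree_vertices_def distinct_adj_Cons)

lemma tree_step_vertex: "t \<in> tree_vertices r \<Longrightarrow> k < r \<Longrightarrow> tree_step k t \<in> tree_vertices r"
  using tree_edge_step by (auto simp: tree_edge_def)

lemma fold_tree_step_vertex: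
  "t \<in> tree_vertices r \<Longrightarrow> set w \<subseteq> {..<r} \<Longrightarrow> fold tree_step w t \<in> tree_vertices r"
  by (induction w arbitrary: t) (auto simp: tree_step_vertex)

lemma seed_pattern_step:
  "seed_pattern r l S \<Longrightarrow> t \<in> tree_vertices r \<Longrightarrow> k < r \<Longrightarrow> S (tree_step k t) = mutate k (S t)"
  using tree_edge_step unfolding seed_pattern_def by blast

text \<open>The walk passes through the root: reading the letters of \<open>t\<close> removes them
  one by one, and reading \<open>t'\<close> backwards rebuilds it.\<close>

lemma tree_connected:
  assumes "t \<in> tree_vertices r" "t' \<in> tree_vertices r"
  shows "\<exists>w. set w \<subseteq> {..<r} \<and> fold tree_step w t = t'"
proof -
  have "fold tree_step s s = []" for s :: "nat list"
    by (induction s) (auto simp: tree_step_def)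
  moreover have "fold tree_step (rev s) [] = s" if "distinct_adj s" for s :: "nat list"
    using that by (induction s) (auto simp: tree_step_def distinct_adj_Cons)
  ultimately have "fold tree_step (t @ rev t') t = t'"
    using assms by (simp add: tree_vertices_def)
  moreover have "set (t @ rev t') \<subseteq> {..<r}" using assms by (auto simp: tree_vertices_def)
  ultimately show ?thesis by blast
qed

section \<open>Quasi-homomorphisms along the tree\<close>

text \<open>\<open>\<psi>\<close> is multiplicative only on the generated algebra, so membership of
  the product is proved along with its image.\<close>

lemma hom_monomial:
  fixes N :: nat
  assumes \<psi>: "rat_algebra_hom_on (rat_algebra_generated X) B \<psi>"
    and y: "\<And>n. n < N \<Longrightarrow> y n \<in> rat_algebra_generated X"
  shows "(\<Prod>n<N. y n ^ e n) \<in> rat_algebra_generated X \<and>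
    \<psi> (\<Prod>n<N. y n ^ e n) = (\<Prod>n<N. \<psi> (y n) ^ e n)"
proof -
  let ?A = "rat_algebra_generated X"
  have one: "1 \<in> ?A" using rat_algebra_generated.scalar[of 1 X] by simp
  have hom: "\<psi> 1 = 1" "\<And>a b. a \<in> ?A \<Longrightarrow> b \<in> ?A \<Longrightarrow> \<psi> (a * b) = \<psi> a * \<psi> b"
    using \<psi> unfolding rat_algebra_hom_on_def ring_hom_on_def by blast+
  have pow: "a ^ m \<in> ?A \<and> \<psi> (a ^ m) = \<psi> a ^ m" if "a \<in> ?A" for a m
    using that by (induction m) (auto simp: one hom intro: rat_algebra_generated.mult)
  show ?thesis
    using y by (induction N) (auto simp: one hom pow intro: rat_algebra_generated.mult)
qed

lemma hom_exchange_poly: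
  assumes \<psi>: "rat_algebra_hom_on (rat_algebra_generated X) B \<psi>"
    and y: "\<And>n. n < N \<Longrightarrow> y n \<in> rat_algebra_generated X"
  shows "\<psi> (exchange_poly N M k y) = exchange_poly N M k (\<lambda>n. \<psi> (y n))"
proof -
  have "\<And>a b. a \<in> rat_algebra_generated X \<Longrightarrow> b \<in> rat_algebra_generated X \<Longrightarrow> \<psi> (a + b) = \<psi> a + \<psi> b"
    using \<psi> unfolding rat_algebra_hom_on_def ring_hom_on_def by blast
  then show ?thesis
    unfolding exchange_poly_def using hom_monomial[OF \<psi>, of N y] y by simp
qed

lemma seed_vars_in_all_variables:
  assumes "seed_pattern r l S" "t \<in> tree_vertices r" "n < r + l"
  shows "seed_vars r (S t) n \<in> all_variables r S"
proof -
  have "is_seed r l (S t)" using assms unfolding seed_pattern_def by blast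
  note dims = is_seed_dims[OF this]
  show ?thesis
  proof (cases "n < r")
    case True
    then have "cluster (S t) $ n \<in> set\<^sub>v (cluster (S t))" using dims by (intro vec_setI) auto
    then show ?thesis using True assms(2)
      by (auto simp: seed_vars_def all_variables_def cluster_variables_def)
  next
    case False
    then have "frozen (S t) $ (n - r) \<in> set\<^sub>v (frozen (S t))"
      using dims assms(3) by (intro vec_setI) auto
    then show ?thesis using False assms(2)
      by (auto simp: seed_vars_def all_variables_def frozen_variables_def)
  qed
qed

lemma all_variablesE:
  assumes "seed_pattern r l S" "x \<in> all_variables r S"
  obtains t n where "t \<in> tree_vertices r" "n < r + l" "x = seed_vars r (S t) n"
proof -
  have "\<exists>t\<in>tree_vertices r. x \<in> set\<^sub>v (cluster (S t)) \<or> x \<in> set\<^sub>v (frozen (S t))"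
    using assms(2) by (auto simp: all_variables_def cluster_variables_def frozen_variables_def)
  then obtain t where t: "t \<in> tree_vertices r"
    "x \<in> set\<^sub>v (cluster (S t)) \<or> x \<in> set\<^sub>v (frozen (S t))" by blast
  have "is_seed r l (S t)" using assms t unfolding seed_pattern_def by blast
  note dims = is_seed_dims[OF this]
  from t(2) show thesis
  proof
    assume "x \<in> set\<^sub>v (cluster (S t))"
    then obtain n where "n < r" "x = cluster (S t) $ n" using dims by (metis vec_setE)
    then show thesis using that[OF t(1), of n] by (simp add: seed_vars_def)
  next
    assume "x \<in> set\<^sub>v (frozen (S t))"
    then obtain n where "n < l" "x = frozen (S t) $ n" using dims by (metis vec_setE)
    then show thesis using that[OF t(1), of "r + n"] by (simp add: seed_vars_def)
  qed
qed

text \<open>The rows \<open>v i\<close> form the matrix \<open>(R, E)\<close> of the quasi-homomorphism \<open>\<psi>\<close> at a pair of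
  corresponding seeds.\<close>

definition twisted ::
    "nat \<Rightarrow> nat \<Rightarrow> nat \<Rightarrow> 'a seed \<Rightarrow> 'b::field_char_0 seed \<Rightarrow> ('a \<Rightarrow> 'b) \<Rightarrow> (nat \<Rightarrow> nat \<Rightarrow> int) \<Rightarrow> bool" where
  "twisted r l l' \<Sigma> \<Sigma>' \<psi> v \<longleftrightarrow>
     (\<forall>n<r. \<psi> (seed_vars r \<Sigma> n)
        = seed_vars r \<Sigma>' n * (\<Prod>i<l'. seed_vars r \<Sigma>' (r + i) powi v i n)) \<and>
     (\<forall>n. r \<le> n \<longrightarrow> n < r + l \<longrightarrow> \<psi> (seed_vars r \<Sigma> n)
        = (\<Prod>i<l'. seed_vars r \<Sigma>' (r + i) powi v i n)) \<and>
     (\<forall>n<r. \<forall>j<r. seed_mat \<Sigma> n j = seed_mat \<Sigma>' n j) \<and>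
     (\<forall>i<l'. \<forall>j<r. (\<Sum>n<r + l. v i n * seed_mat \<Sigma> n j) = seed_mat \<Sigma>' (r + i) j)"

text \<open>The variable is handled by \<open>exchange_poly_twist\<close>, the matrix condition by
  \<open>mut_trop_relation\<close>. Even if R = 0 at the start, it may become nonzero along the way,
  so \<open>v\<close> has entries at cluster indices too.\<close>

lemma twisted_mutate:
  assumes seeds: "is_seed r l \<Sigma>" "is_seed r l' \<Sigma>'" and k: "k < r"
    and \<psi>: "rat_algebra_hom_on (rat_algebra_generated X) B \<psi>"
    and mem: "\<And>n. n < r + l \<Longrightarrow> seed_vars r \<Sigma> n \<in> rat_algebra_generated X"
      "seed_vars r (mutate k \<Sigma>) k \<in> rat_algebra_generated X"
    and tw: "twisted r l l' \<Sigma> \<Sigma>' \<psi> v"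
  shows "twisted r l l' (mutate k \<Sigma>) (mutate k \<Sigma>') \<psi> (\<lambda>i. mut_trop (r + l) (seed_mat \<Sigma>) k (v i))"
proof -
  define N where "N = r + l"
  define N' where "N' = r + l'"
  define x where "x = seed_vars r \<Sigma>"
  define x' where "x' = seed_vars r \<Sigma>'"
  define M where "M = seed_mat \<Sigma>"
  define M' where "M' = seed_mat \<Sigma>'"
  define v' where "v' i = mut_trop N M k (v i)" for i
  have tw1: "\<And>n. n < r \<Longrightarrow> \<psi> (x n) = x' n * (\<Prod>i<l'. x' (r + i) powi v i n)"
    and tw2: "\<And>n. r \<le> n \<Longrightarrow> n < N \<Longrightarrow> \<psi> (x n) = (\<Prod>i<l'. x' (r + i) powi v i n)"
    and tw3: "\<And>n j. n < r \<Longrightarrow> j < r \<Longrightarrow> M n j = M' n j"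
    and tw4: "\<And>i j. i < l' \<Longrightarrow> j < r \<Longrightarrow> (\<Sum>n<N. v i n * M n j) = M' (r + i) j"
    using tw by (auto simp: twisted_def x_def x'_def M_def M'_def N_def)
  have diag: "M k k = 0" using is_seed_skew[OF seeds(1)] skew_diag k by (auto simp: M_def)
  have nz: "x k \<noteq> 0" "x' k \<noteq> 0" "\<And>i. i < l' \<Longrightarrow> x' (r + i) \<noteq> 0"
    using seed_vars_nonzero[OF seeds(1)] seed_vars_nonzero[OF seeds(2)] k
    by (auto simp: x_def x'_def)
  have mul: "\<And>a b. a \<in> rat_algebra_generated X \<Longrightarrow> b \<in> rat_algebra_generated X \<Longrightarrow> \<psi> (a * b) = \<psi> a * \<psi> b"
    using \<psi> unfolding rat_algebra_hom_on_def ring_hom_on_def by blast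
  have mx: "seed_vars r (mutate k \<Sigma>) n = mut_vars N M k x n" for n
    by (simp add: seed_vars_mutate[OF seeds(1) k] N_def M_def x_def)
  have mx': "seed_vars r (mutate k \<Sigma>') n = mut_vars N' M' k x' n" for n
    by (simp add: seed_vars_mutate[OF seeds(2) k] N'_def M'_def x'_def)
  have mx'_frozen: "seed_vars r (mutate k \<Sigma>') (r + i) = x' (r + i)" for i
    using k by (simp add: mx' mut_vars_def)
  have exch: "exchange_poly N M k (\<lambda>n. \<psi> (x n)) = (\<Prod>i<l'. x' (r + i) powi
      min (\<Sum>n<N. int (nat (M n k)) * v i n) (\<Sum>n<N. int (nat (- M n k)) * v i n))
    * exchange_poly N' M' k x'"
    unfolding N'_def by (rule exchange_poly_twist) (use tw1 tw2 tw3 tw4 nz k in \<open>auto simp: N_def\<close>)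
  have "\<psi> (mut_vars N M k x k) = mut_vars N' M' k x' k * (\<Prod>i<l'. x' (r + i) powi v' i k)"
  proof -
    \<comment> \<open>\<open>\<psi>\<close> is applied to the exchange relation as a product,
      because the inverse of \<open>x k\<close> need not lie in the algebra.\<close>
    have "mut_vars N M k x k * x k = exchange_poly N M k x" using nz by (simp add: mut_vars_def)
    then have "\<psi> (mut_vars N M k x k) * \<psi> (x k) = \<psi> (exchange_poly N M k x)"
      using mul mem k by (metis mx x_def trans_less_add1)
    also have "\<dots> = exchange_poly N M k (\<lambda>n. \<psi> (x n))"
      by (rule hom_exchange_poly[OF \<psi>]) (use mem in \<open>simp add: N_def x_def\<close>)
    also have "\<dots> = (\<Prod>i<l'. x' (r + i) powi (v' i k + v i k)) * exchange_poly N' M' k x'"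
      unfolding exch by (simp add: v'_def mut_trop_def)
    also have "(\<Prod>i<l'. x' (r + i) powi (v' i k + v i k))
        = (\<Prod>i<l'. x' (r + i) powi v' i k) * (\<Prod>i<l'. x' (r + i) powi v i k)"
      using nz by (simp add: power_int_add flip: prod.distrib)
    finally have "\<psi> (mut_vars N M k x k) * (x' k * (\<Prod>i<l'. x' (r + i) powi v i k))
        = (\<Prod>i<l'. x' (r + i) powi v' i k) * (\<Prod>i<l'. x' (r + i) powi v i k) * exchange_poly N' M' k x'"
      using tw1[OF k] by simp
    moreover have "(\<Prod>i<l'. x' (r + i) powi v i k) \<noteq> 0" using nz by simp
    ultimately have "\<psi> (mut_vars N M k x k) * x' k
        = (\<Prod>i<l'. x' (r + i) powi v' i k) * exchange_poly N' M' k x'" by (simp add: mult_ac)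
    then show ?thesis using nz by (simp add: mut_vars_def field_simps)
  qed
  then have 1: "\<psi> (mut_vars N M k x n) = mut_vars N' M' k x' n * (\<Prod>i<l'. x' (r + i) powi v' i n)"
    if "n < r" for n
    using tw1[OF that] by (cases "n = k") (simp_all add: mut_vars_def v'_def mut_trop_def)
  have 2: "\<psi> (mut_vars N M k x n) = (\<Prod>i<l'. x' (r + i) powi v' i n)" if "r \<le> n" "n < N" for n
    using tw2[OF that] that k by (simp add: mut_vars_def v'_def mut_trop_def)
  have 3: "mut_mat k M n j = mut_mat k M' n j" if "n < r" "j < r" for n j
    using tw3 that k by (simp add: mut_mat_def)
  have 4: "(\<Sum>n<N. v' i n * mut_mat k M n j) = mut_mat k M' (r + i) j" if "i < l'" "j < r" for i j
    unfolding v'_def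
    using mut_trop_relation[of M k N "v i" "\<lambda>j. M' (r + i) j" j, OF diag]
      tw4[OF that(1) k] tw4[OF that] tw3[OF k that(2)] k
    by (simp add: mut_mat_def N_def)
  have mm: "seed_mat (mutate k \<Sigma>) n j = mut_mat k M n j" if "n < N" "j < r" for n j
    using seed_mat_mutate[OF seeds(1) k] that by (simp add: N_def M_def)
  have mm': "seed_mat (mutate k \<Sigma>') n j = mut_mat k M' n j" if "n < N'" "j < r" for n j
    using seed_mat_mutate[OF seeds(2) k] that by (simp add: N'_def M'_def)
  show ?thesis
    unfolding twisted_def mx mx'_frozen N_def[symmetric] M_def[symmetric] v'_def[symmetric]
    using 1 2 3 4 by (simp add: mx' mm mm' N_def N'_def)
qed

text \<open>Seeds correspond when they are reached by the same labels from \<open>t\<close> and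
  \<open>t'\<close>; the vertices themselves may differ.\<close>

lemma twisted_fold:
  assumes S: "seed_pattern r l S" "seed_pattern r l' S'"
    and \<psi>: "rat_algebra_hom_on (cluster_algebra_rat r S) B \<psi>"
    and "t \<in> tree_vertices r" "t' \<in> tree_vertices r" "set w \<subseteq> {..<r}"
    and "twisted r l l' (S t) (S' t') \<psi> v"
  shows "twisted r l l' (S (fold tree_step w t)) (S' (fold tree_step w t')) \<psi>
    (\<lambda>i. mut_trop_seq (r + l) (seed_mat (S t)) w (v i))"
  using assms(4-)
proof (induction w arbitrary: t t' v)
  case (Cons k w)
  then have k: "k < r" and w: "set w \<subseteq> {..<r}" by auto
  have seeds: "is_seed r l (S t)" "is_seed r l' (S' t')"
    using S Cons.prems unfolding seed_pattern_def by blast+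
  have step: "S (tree_step k t) = mutate k (S t)" "S' (tree_step k t') = mutate k (S' t')"
    using S Cons.prems k seed_pattern_step by blast+
  have vert: "tree_step k t \<in> tree_vertices r" "tree_step k t' \<in> tree_vertices r"
    using Cons.prems k tree_step_vertex by blast+
  have mem: "seed_vars r (S s) n
      \<in> rat_algebra_generated (all_variables r S \<union> inverse ` frozen_variables r S)"
    if "s \<in> tree_vertices r" "n < r + l" for s n
    using seed_vars_in_all_variables[OF S(1) that] by (auto intro: rat_algebra_generated.base)
  have "twisted r l l' (S (tree_step k t)) (S' (tree_step k t')) \<psi>
      (\<lambda>i. mut_trop (r + l) (seed_mat (S t)) k (v i))"
    unfolding step using \<psi>[unfolded cluster_algebra_rat_def]
    by (rule twisted_mutate[OF seeds k])
      (use mem Cons.prems k vert(1) in \<open>auto simp flip: step\<close>)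
  from Cons.IH[OF vert w this]
  have "twisted r l l' (S (fold tree_step w (tree_step k t))) (S' (fold tree_step w (tree_step k t'))) \<psi>
      (\<lambda>i. mut_trop_seq (r + l) (seed_mat (mutate k (S t))) w (mut_trop (r + l) (seed_mat (S t)) k (v i)))"
    by (simp add: step)
  moreover have "mut_trop_seq (r + l) (seed_mat (mutate k (S t))) w
      = mut_trop_seq (r + l) (mut_mat k (seed_mat (S t))) w"
    by (intro ext, subst mut_trop_seq_cong[of "r + l" r "seed_mat (mutate k (S t))"])
      (use seed_mat_mutate[OF seeds(1) k] w in auto)
  ultimately show ?case by simp
qed simp

section \<open>Generated semirings and rings\<close>

lemma semiring_generated_mult_prod:
  fixes n :: nat
  assumes "\<And>i. i < n \<Longrightarrow> x i \<in> X" "y = 1 \<or> y \<in> semiring_generated X"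
  shows "y * (\<Prod>i<n. x i ^ e i) \<in> semiring_generated X"
proof -
  have pow: "a ^ m \<in> semiring_generated X" if "a \<in> X" for a m
    using that by (induction m) (auto intro: semiring_generated.intros)
  have "(\<Prod>i<n. x i ^ e i) \<in> semiring_generated X"
    using assms(1) by (induction n) (auto intro: semiring_generated.one semiring_generated.mult pow)
  then show ?thesis using assms(2) by (auto intro: semiring_generated.intros)
qed

lemma semiring_generated_subset: "semiring_generated X \<subseteq> ring_generated X"
proof
  fix x assume "x \<in> semiring_generated X"
  then show "x \<in> ring_generated X" by (induction rule: semiring_generated.induct) (auto intro: ring_generated.intros)
qed

lemma ring_generated_subset: "ring_generated X \<subseteq> rat_algebra_generated (X \<union> Y)"
proof
  fix x assume "x \<in> ring_generated X"
  then show "x \<in> rat_algebra_generated (X \<union> Y)"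
  proof (induction rule: ring_generated.induct)
    case one
    show ?case using rat_algebra_generated.scalar[of 1] by simp
  next
    case (uminus x)
    then show ?case using rat_algebra_generated.mult[OF rat_algebra_generated.scalar[of "-1"]]
      by (force simp: of_rat_minus)
  qed (auto intro: rat_algebra_generated.intros)
qed

lemma hom_ring_generated:
  assumes \<psi>: "rat_algebra_hom_on (rat_algebra_generated (X \<union> Y)) B \<psi>"
    and X: "\<And>x. x \<in> X \<Longrightarrow> \<psi> x \<in> ring_generated X'" and x: "x \<in> ring_generated X"
  shows "\<psi> x \<in> ring_generated X'"
proof -
  let ?A = "rat_algebra_generated (X \<union> Y)"
  have hom: "\<psi> 1 = 1" "\<And>a b. a \<in> ?A \<Longrightarrow> b \<in> ?A \<Longrightarrow> \<psi> (a + b) = \<psi> a + \<psi> b \<and> \<psi> (a * b) = \<psi> a * \<psi> b"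
    "\<And>q a. a \<in> ?A \<Longrightarrow> \<psi> (of_rat q * a) = of_rat q * \<psi> a"
    using \<psi> unfolding rat_algebra_hom_on_def ring_hom_on_def by blast+
  from x show ?thesis
  proof (induction rule: ring_generated.induct)
    case (uminus x)
    then have "\<psi> (- x) = - \<psi> x" using hom(3)[of x "-1"] ring_generated_subset[of X Y] by (auto simp: of_rat_minus)
    then show ?case using uminus by (auto intro: ring_generated.intros)
  next
    case (add x y)
    then have "\<psi> (x + y) = \<psi> x + \<psi> y" using hom(2) ring_generated_subset[of X Y] by blast
    then show ?case using add by (auto intro: ring_generated.intros)
  next
    case (mult x y)
    then have "\<psi> (x * y) = \<psi> x * \<psi> y" using hom(2) ring_generated_subset[of X Y] by blast
    then show ?case using mult by (auto intro: ring_generated.intros)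
  qed (auto simp: hom(1) X intro: ring_generated.intros)
qed

section \<open>Specialising one frozen variable to zero\<close>

text \<open>Of the two monomials of an exchange polynomial at most one contains a given frozen variable,
  so setting that variable to zero leaves a positive value.\<close>

lemma exchange_poly_pos_if_one_zero:
  fixes q :: "nat \<Rightarrow> 'a::linordered_field"
  assumes "\<And>n. n < N \<Longrightarrow> n \<noteq> m \<Longrightarrow> q n > 0" "q m = 0"
  shows "exchange_poly N M k q > 0"
proof -
  have nonneg: "(\<Prod>n<N. q n ^ e n) \<ge> 0" for e
    using assms by (intro prod_nonneg zero_le_power) (metis atLeast0LessThan lessThan_iff less_imp_le order_refl)
  have pos: "(\<Prod>n<N. q n ^ e n) > 0" if "e m = 0" for e
  proof (rule prod_pos)
    fix n assume "n \<in> {..<N}"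
    then show "q n ^ e n > 0" using assms that by (cases "n = m") auto
  qed
  show ?thesis
  proof (cases "M m k \<le> 0")
    case True
    then show ?thesis unfolding exchange_poly_def by (intro add_pos_nonneg nonneg pos) simp
  next
    case False
    then show ?thesis unfolding exchange_poly_def by (intro add_nonneg_pos nonneg pos) simp
  qed
qed

lemma specialises_exchange_poly:
  "(\<And>n. n < N \<Longrightarrow> specialises x p (y n) (q n)) \<Longrightarrow>
    specialises x p (exchange_poly N M k y) (exchange_poly N M k q)"
  unfolding exchange_poly_def by (intro specialises_add specialises_prod specialises_power) auto

text \<open>The values \<open>q\<close> mutate along with the seed. Division is always by
  \<open>q k\<close> with \<open>k < r\<close>, a positive number, and never by the coordinate
  \<open>r + i\<close> that was set to 0.\<close>

lemma specialises_seed_vars: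
  assumes S: "seed_pattern r l S" and x: "alg_independent x" and i: "i < l"
    and "t \<in> tree_vertices r" "set w \<subseteq> {..<r}"
    and "\<And>n. n < r + l \<Longrightarrow> specialises x p (seed_vars r (S t) n) (q n)"
    and "\<And>n. n < r + l \<Longrightarrow> n \<noteq> r + i \<Longrightarrow> q n > 0" "q (r + i) = 0"
  shows "n < r + l \<Longrightarrow> \<exists>c. specialises x p (seed_vars r (S (fold tree_step w t)) n) c"
  using assms(4-)
proof (induction w arbitrary: t q)
  case (Cons k w)
  then have k: "k < r" and w: "set w \<subseteq> {..<r}" by auto
  have seed: "is_seed r l (S t)" using S Cons.prems unfolding seed_pattern_def by blast
  define q' where "q' = q(k := exchange_poly (r + l) (seed_mat (S t)) k q / q k)"
  have "exchange_poly (r + l) (seed_mat (S t)) k q > 0"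
    by (rule exchange_poly_pos_if_one_zero[of _ "r + i"]) (use Cons.prems in auto)
  moreover have qk: "q k > 0" using Cons.prems(5)[of k] k by simp
  ultimately have q': "\<And>n. n < r + l \<Longrightarrow> n \<noteq> r + i \<Longrightarrow> q' n > 0" "q' (r + i) = 0"
    using Cons.prems k by (auto simp: q'_def)
  have "specialises x p (seed_vars r (S (tree_step k t)) n) (q' n)" if n: "n < r + l" for n
  proof (cases "n = k")
    case True
    have "specialises x p (exchange_poly (r + l) (seed_mat (S t)) k (seed_vars r (S t))
        * inverse (seed_vars r (S t) k)) (exchange_poly (r + l) (seed_mat (S t)) k q * inverse (q k))"
      using Cons.prems k less_imp_neq[OF qk]
      by (intro specialises_mult specialises_exchange_poly specialises_inverse x) auto
    then show ?thesis using True
      by (simp add: seed_pattern_step[OF S Cons.prems(2) k] seed_vars_mutate[OF seed k]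
          mut_vars_def q'_def divide_inverse)
  next
    case False
    then show ?thesis using Cons.prems(4)[OF n]
      by (simp add: seed_pattern_step[OF S Cons.prems(2) k] seed_vars_mutate[OF seed k]
          mut_vars_def q'_def)
  qed
  from Cons.IH[OF Cons.prems(1) tree_step_vertex[OF Cons.prems(2) k] w this q']
  show ?case by simp
qed auto

lemma specialises_ring_generated:
  assumes "\<And>a. a \<in> X \<Longrightarrow> \<exists>c. specialises x p a c" "a \<in> ring_generated X"
  shows "\<exists>c. specialises x p a c"
  using assms(2)
  by (induction rule: ring_generated.induct) (auto intro: assms(1) specialises_one specialises_add specialises_uminus specialises_mult)

theorem corollary4p12:
  fixes r l l' :: nat
    and S :: "nat list \<Rightarrow> 'a::field_char_0 seed"
    and S' :: "nat list \<Rightarrow> 'b::field_char_0 seed"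
    and t\<^sub>0 t\<^sub>0' :: "nat list"
    and E :: "int mat"
    and \<psi> :: "'a \<Rightarrow> 'b"
  assumes "seed_pattern r l S"
    and "seed_pattern r l' S'"
    and "t\<^sub>0 \<in> tree_vertices r"
    and "t\<^sub>0' \<in> tree_vertices r"
    and "exchange_part (S t\<^sub>0) = exchange_part (S' t\<^sub>0')"
    and "E \<in> carrier_mat l' l"
    and "E * coefficient_part (S t\<^sub>0) = coefficient_part (S' t\<^sub>0')"
    and "quasi_homomorphism r l l' S S' \<psi>"
    and "map_vec \<psi> (cluster (S t\<^sub>0)) = cluster (S' t\<^sub>0')"
    and "map_vec \<psi> (frozen (S t\<^sub>0)) = mat_power (frozen (S' t\<^sub>0')) E"
  shows "property_F r S S' \<psi> \<longleftrightarrow> 0\<^sub>m l' l \<le> E"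
proof -
  define x where "x = seed_vars r (S t\<^sub>0)"
  define x' where "x' = seed_vars r (S' t\<^sub>0')"
  have seeds: "is_seed r l (S t\<^sub>0)" "is_seed r l' (S' t\<^sub>0')"
    using assms(1-4) unfolding seed_pattern_def by blast+
  note dims = is_seed_dims[OF seeds(1)] is_seed_dims[OF seeds(2)]
  have \<psi>: "rat_algebra_hom_on (cluster_algebra_rat r S) (cluster_algebra_rat r S') \<psi>"
    using assms(8) by (simp add: quasi_homomorphism_def)
  have E: "dim_row E = l'" "dim_col E = l" using assms(6) by auto
  have \<psi>_cluster: "\<psi> (x n) = x' n" if "n < r" for n
    using arg_cong[OF assms(9), of "\<lambda>u. u $ n"] dims that by (simp add: x_def x'_def seed_vars_def)
  have \<psi>_frozen: "\<psi> (x (r + a)) = (\<Prod>i<l'. x' (r + i) powi E $$ (i, a))" if "a < l" for a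
    using arg_cong[OF assms(10), of "\<lambda>u. u $ a"] dims that E
    by (simp add: x_def x'_def seed_vars_def mat_power_def vec_power_def)
  show ?thesis
  proof
    assume le: "0\<^sub>m l' l \<le> E"
    \<comment> \<open>Row i of (0, E), continued by 0 beyond the matrix, as
      \<open>mut_trop_seq_nonneg\<close> demands.\<close>
    define v where "v i n = (if r \<le> n \<and> n < r + l then E $$ (i, n - r) else 0)" for i n
    have "twisted r l l' (S t\<^sub>0) (S' t\<^sub>0') \<psi> v"
      unfolding twisted_def
    proof (intro conjI allI impI)
      fix n assume "n < r"
      then show "\<psi> (seed_vars r (S t\<^sub>0) n) = seed_vars r (S' t\<^sub>0') n *
          (\<Prod>i<l'. seed_vars r (S' t\<^sub>0') (r + i) powi v i n)"
        using \<psi>_cluster by (simp add: v_def x_def x'_def)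
    next
      fix n assume "r \<le> n" "n < r + l"
      then show "\<psi> (seed_vars r (S t\<^sub>0) n) = (\<Prod>i<l'. seed_vars r (S' t\<^sub>0') (r + i) powi v i n)"
        using \<psi>_frozen[of "n - r"] by (simp add: v_def x_def x'_def)
    next
      fix n j assume "n < r" "j < r"
      then show "seed_mat (S t\<^sub>0) n j = seed_mat (S' t\<^sub>0') n j"
        using arg_cong[OF assms(5), of "\<lambda>A. A $$ (n, j)"] dims
        by (simp add: exchange_part_def seed_mat_def)
    next
      fix i j assume i: "i < l'" and j: "j < r"
      have "(\<Sum>n<r + l. v i n * seed_mat (S t\<^sub>0) n j) = (\<Sum>a<l. E $$ (i, a) * seed_mat (S t\<^sub>0) (r + a) j)"
      proof -
        have sum: "(\<Sum>n<r + m. v i n * seed_mat (S t\<^sub>0) n j) = (\<Sum>a<m. v i (r + a) * seed_mat (S t\<^sub>0) (r + a) j)"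
          for m by (induction m) (auto simp: v_def)
        show ?thesis unfolding sum by (intro sum.cong) (auto simp: v_def)
      qed
      also have "\<dots> = (E * coefficient_part (S t\<^sub>0)) $$ (i, j)"
        using i j E dims by (simp add: coefficient_part_def scalar_prod_def seed_mat_def atLeast0LessThan)
      also have "\<dots> = seed_mat (S' t\<^sub>0') (r + i) j"
        unfolding assms(7) using i j dims by (simp add: coefficient_part_def seed_mat_def)
      finally show "(\<Sum>n<r + l. v i n * seed_mat (S t\<^sub>0) n j) = seed_mat (S' t\<^sub>0') (r + i) j" .
    qed
    note tw = twisted_fold[OF assms(1,2) \<psi> assms(3,4) _ this]
    have image: "\<psi> y \<in> cluster_semiring r S'" if y: "y \<in> all_variables r S" for y
    proof -
      obtain t n where t: "t \<in> tree_vertices r" "n < r + l" "y = seed_vars r (S t) n"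
        using all_variablesE[OF assms(1) y] by blast
      obtain w where w: "set w \<subseteq> {..<r}" "fold tree_step w t\<^sub>0 = t"
        using tree_connected[OF assms(3) t(1)] by blast
      define t' where "t' = fold tree_step w t\<^sub>0'"
      have t': "t' \<in> tree_vertices r" using assms(4) w fold_tree_step_vertex by (simp add: t'_def)
      define e where "e i = mut_trop_seq (r + l) (seed_mat (S t\<^sub>0)) w (v i) n" for i
      have "e i \<ge> 0" if "i < l'" for i
        unfolding e_def
      proof (rule mut_trop_seq_nonneg[OF is_seed_skew[OF seeds(1)]])
        show "v i m \<ge> 0" if "r \<le> m" "m < r + l" for m
          using le that \<open>i < l'\<close> E by (simp add: v_def less_eq_mat_def)
      qed (use w t in \<open>auto simp: v_def\<close>)
      then have pow: "(\<Prod>i<l'. seed_vars r (S' t') (r + i) powi e i)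
          = (\<Prod>i<l'. seed_vars r (S' t') (r + i) ^ nat (e i))"
        by (intro prod.cong) (auto simp: power_int_def)
      \<comment> \<open>Frozen variables are sent to pure monomials, so their leading factor is
        1.\<close>
      have "\<psi> y = (if n < r then seed_vars r (S' t') n else 1)
          * (\<Prod>i<l'. seed_vars r (S' t') (r + i) powi e i)"
        using tw[OF w(1)] t(2) unfolding twisted_def e_def t'_def t(3) w(2) by auto
      moreover have "(if n < r then seed_vars r (S' t') n else 1)
          * (\<Prod>i<l'. seed_vars r (S' t') (r + i) ^ nat (e i)) \<in> cluster_semiring r S'"
        unfolding cluster_semiring_def
        using seed_vars_in_all_variables[OF assms(2) t']
        by (intro semiring_generated_mult_prod) (auto intro: semiring_generated.base)
      ultimately show ?thesis unfolding pow by simp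
    qed
    have sub: "cluster_ring_int r S \<subseteq> cluster_algebra_rat r S"
      unfolding cluster_ring_int_def cluster_algebra_rat_def by (rule ring_generated_subset)
    have "\<psi> y \<in> cluster_ring_int r S'" if "y \<in> cluster_ring_int r S" for y
      using hom_ring_generated[OF \<psi>[unfolded cluster_algebra_rat_def]] that image
        semiring_generated_subset[of "all_variables r S'"]
      unfolding cluster_ring_int_def cluster_semiring_def by blast
    then have "ring_hom_on (cluster_ring_int r S) (cluster_ring_int r S') \<psi>"
      using \<psi> sub unfolding rat_algebra_hom_on_def ring_hom_on_def by blast
    then show "property_F r S S' \<psi>" using image by (auto simp: property_F_def)
  next
    assume F: "property_F r S S' \<psi>"
    have "E $$ (i, a) \<ge> 0" if i: "i < l'" and a: "a < l" for i a
    proof (rule ccontr)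
      assume neg: "\<not> E $$ (i, a) \<ge> 0"
      define u where "u = cluster (S' t\<^sub>0') @\<^sub>v frozen (S' t\<^sub>0')"
      have u: "alg_independent u" "dim_vec u = r + l'"
        using seeds(2) dims by (auto simp: u_def is_seed_def freely_generates_def)
      define q :: "nat \<Rightarrow> rat" where "q n = (if n = r + i then 0 else 1)" for n
      define p where "p = vec (r + l') q"
      have sp: "specialises u p (x' n) (q n)" if "n < r + l'" for n
        using specialises_var[of n u p] that dims u
        by (auto simp: x'_def seed_vars_def u_def p_def)
      have all: "\<exists>c. specialises u p y c" if y: "y \<in> all_variables r S'" for y
      proof -
        obtain t n where t: "t \<in> tree_vertices r" "n < r + l'" "y = seed_vars r (S' t) n"
          using all_variablesE[OF assms(2) y] by blast
        obtain w where w: "set w \<subseteq> {..<r}" "fold tree_step w t\<^sub>0' = t"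
          using tree_connected[OF assms(4) t(1)] by blast
        show ?thesis
          using specialises_seed_vars[OF assms(2) u(1) i assms(4) w(1), of p q n] sp t w
          by (simp add: x'_def q_def)
      qed
      have "x (r + a) \<in> all_variables r S"
        unfolding x_def using a by (intro seed_vars_in_all_variables[OF assms(1,3)]) simp
      then have "\<psi> (x (r + a)) \<in> ring_generated (all_variables r S')"
        using F semiring_generated_subset[of "all_variables r S'"]
        unfolding property_F_def cluster_semiring_def by blast
      then obtain c where c: "specialises u p (\<psi> (x (r + a))) c"
        using specialises_ring_generated[OF all] by blast
      have mono: "specialises u p (\<Prod>b<l'. x' (r + b) ^ e b) (\<Prod>b<l'. q (r + b) ^ e b)" for e
        by (intro specialises_prod specialises_power sp) simp
      \<comment> \<open>Negative exponents are moved to the left-hand side, as the value 0 has no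
        usable inverse. At \<open>p\<close> the left side then becomes c times 0 and the right side
        becomes 1.\<close>
      have "\<psi> (x (r + a)) * (\<Prod>b<l'. x' (r + b) ^ nat (- E $$ (b, a)))
          = (\<Prod>b<l'. x' (r + b) ^ nat (E $$ (b, a)))"
        unfolding \<psi>_frozen[OF a] prod.distrib[symmetric]
      proof (intro prod.cong refl)
        fix b assume "b \<in> {..<l'}"
        then have "x' (r + b) \<noteq> 0" using seed_vars_nonzero[OF seeds(2)] by (simp add: x'_def)
        then show "x' (r + b) powi E $$ (b, a) * x' (r + b) ^ nat (- E $$ (b, a))
            = x' (r + b) ^ nat (E $$ (b, a))"
          by (auto simp: power_int_def field_simps)
      qed
      with specialises_mult[OF c mono, of "\<lambda>b. nat (- E $$ (b, a))"]
      have "c * (\<Prod>b<l'. q (r + b) ^ nat (- E $$ (b, a))) = (\<Prod>b<l'. q (r + b) ^ nat (E $$ (b, a)))"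
        using mono[of "\<lambda>b. nat (E $$ (b, a))"] specialises_unique[OF u(1)] by simp
      moreover have "(\<Prod>b<l'. q (r + b) ^ nat (- E $$ (b, a))) = 0"
        using i neg by (intro prod_zero bexI[of _ i]) (auto simp: q_def zero_power)
      moreover have "(\<Prod>b<l'. q (r + b) ^ nat (E $$ (b, a))) = 1"
        using neg by (intro prod.neutral) (auto simp: q_def)
      ultimately show False by simp
    qed
    then show "0\<^sub>m l' l \<le> E" using E by (simp add: less_eq_mat_def)
  qed
qed

end
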